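(* Let $(\mathbf Z_n,\mathbf A_{n\times n})$ be generated from the stochastic block model with parameters $(k,\pi,\rho_nS)$. If $\alpha<\min_a\pi_a$ and $n\rho_n\to\infty$ as $n\to\infty$, then both $\hat{\mathbf z}_n^{\mathrm{ML}}$ and $\hat{\mathbf z}_n^{\mathrm{ICL}}$ are weakly consistent. Moreover, $\alpha$ can be taken as decreasing with $n$, at a rate $\alpha\gg(n\rho_n)^{-1/2}$.
   Context: Stochastic block model (SBM) with parameters $(k,\pi,\rho_nS)$: $k\ge2$ fixed; $\pi$ a probability vector on $[k]=\{1,\dots,k\}$ with all $\pi_a>0$; $S$ a fixed symmetric $k\times k$ matrix with strictly positive entries and no two identical columns; $\rho_n>0$ with $\rho_n\to0$. The labels $\mathbf Z_n=(Z_1,\dots,Z_n)$ are i.i.d. with law $\pi$; given $\mathbf Z_n=\mathbf z_n$, the adjacency matrix $\mathbf A_{n\times n}$ is symmetric with zero diagonal and entries $A_{ij}$, $i<j$, independent Bernoulli$(\rho_nS_{z_iz_j})$. For $\mathbf e_n\in[k]^n$ and the observed matrix $a$: $n_a(\mathbf e_n)=\#\{i:e_i=a\}$; $n_{ab}=n_an_b$ for $a\ne b$, $n_{aa}=n_a(n_a-1)$; $o_{ab}(\mathbf e_n)=\sum_{i,j}\mathbf 1\{e_i=a,e_j=b\}a_{ij}$; $\tau(x)=x\log x+(1-x)\log(1-x)$. $Q_{\mathrm{ML}}(\mathbf e_n)=\frac1{2n^2}\sum_{a,b}n_{ab}\tau(o_{ab}/n_{ab})$. With $\tilde o_{aa}=o_{aa}/2,\tilde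 n_{aa}=n_{aa}/2$ and $\tilde o_{ab}=o_{ab},\tilde n_{ab}=n_{ab}$ for $a\ne b$, $Q_{\mathrm{ICL}}(\mathbf e_n)=\frac1{n^2}\sum_{a\le b}\log\frac{B(\tilde o_{ab}+1/2,\tilde n_{ab}-\tilde o_{ab}+1/2)}{B(1/2,1/2)}$ ($B$ the beta function). For $\alpha>0$ let $\mathcal F(n,\alpha)=\{\mathbf e_n\in[k]^n: n_a(\mathbf e_n)\ge\alpha n\ \forall a\}$; $\hat{\mathbf z}_n^{\mathrm{ML}}$ (resp. $\hat{\mathbf z}_n^{\mathrm{ICL}}$) is a maximizer of $Q_{\mathrm{ML}}$ (resp. $Q_{\mathrm{ICL}}$) over $\mathcal F(n,\alpha)$. Let $m(\hat{\mathbf z}_n,\mathbf Z_n)=\min_\sigma\sum_{i=1}^n\mathbf 1\{\hat z_i\ne\sigma(Z_i)\}$, the minimum over permutations $\sigma$ of $[k]$. An estimator is weakly consistent if for all $\epsilon>0$, $\mathbb P(m(\hat{\mathbf z}_n,\mathbf Z_n)<\epsilon n)\to1$. *)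

theory Defs
  imports "HOL-Analysis.Analysis" "HOL-Probability.Probability" "HOL-Combinatorics.Permutations"
begin

text \<open>Community labels are 0,...,k-1 (i.e. [k] shifted by one); nodes are 0,...,n-1.
  A labelling is a function nat => nat; entries at indices >= n are irrelevant.
  An observed adjacency matrix is a function nat => nat => bool.\<close>

definition sym_adj :: "(nat \<times> nat \<Rightarrow> bool) \<Rightarrow> nat \<Rightarrow> nat \<Rightarrow> bool" where
  "sym_adj B i j = (if i < j then B (i, j) else if j < i then B (j, i) else False)"

definition sbm :: "nat pmf \<Rightarrow> (nat \<Rightarrow> nat \<Rightarrow> real) \<Rightarrow> (nat \<Rightarrow> real) \<Rightarrow> nat
    \<Rightarrow> ((nat \<Rightarrow> nat) \<times> (nat \<Rightarrow> nat \<Rightarrow> bool)) pmf" where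
  "sbm p S \<rho> n =
     bind_pmf (Pi_pmf {..<n} 0 (\<lambda>_. p)) (\<lambda>z.
       map_pmf (\<lambda>B. (z, sym_adj B))
         (Pi_pmf {(i, j). i < j \<and> j < n} False
            (\<lambda>(i, j). bernoulli_pmf (\<rho> n * S (z i) (z j)))))"

definition cnt :: "nat \<Rightarrow> (nat \<Rightarrow> nat) \<Rightarrow> nat \<Rightarrow> real" where
  "cnt n e a = real (card {i. i < n \<and> e i = a})"

definition npair :: "nat \<Rightarrow> (nat \<Rightarrow> nat) \<Rightarrow> nat \<Rightarrow> nat \<Rightarrow> real" where
  "npair n e a b = (if a \<noteq> b then cnt n e a * cnt n e b else cnt n e a * (cnt n e a - 1))"

definition opair :: "nat \<Rightarrow> (nat \<Rightarrow> nat \<Rightarrow> bool) \<Rightarrow> (nat \<Rightarrow> nat) \<Rightarrow> nat \<Rightarrow> nat \<Rightarrow> real" where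
  "opair n A e a b = (\<Sum>i<n. \<Sum>j<n. if e i = a \<and> e j = b \<and> A i j then 1 else 0)"

text \<open>tau(x) = x log x + (1-x) log(1-x), with the convention 0 log 0 = 0.\<close>
definition tau :: "real \<Rightarrow> real" where
  "tau x = (if x \<le> 0 \<or> 1 \<le> x then 0 else x * ln x + (1 - x) * ln (1 - x))"

definition Q_ML :: "nat \<Rightarrow> nat \<Rightarrow> (nat \<Rightarrow> nat \<Rightarrow> bool) \<Rightarrow> (nat \<Rightarrow> nat) \<Rightarrow> real" where
  "Q_ML k n A e = 1 / (2 * real n ^ 2) *
     (\<Sum>a<k. \<Sum>b<k. npair n e a b * tau (opair n A e a b / npair n e a b))"

definition otil :: "nat \<Rightarrow> (nat \<Rightarrow> nat \<Rightarrow> bool) \<Rightarrow> (nat \<Rightarrow> nat) \<Rightarrow> nat \<Rightarrow> nat \<Rightarrow> real" where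
  "otil n A e a b = (if a = b then opair n A e a b / 2 else opair n A e a b)"

definition ntil :: "nat \<Rightarrow> (nat \<Rightarrow> nat) \<Rightarrow> nat \<Rightarrow> nat \<Rightarrow> real" where
  "ntil n e a b = (if a = b then npair n e a b / 2 else npair n e a b)"

definition Q_ICL :: "nat \<Rightarrow> nat \<Rightarrow> (nat \<Rightarrow> nat \<Rightarrow> bool) \<Rightarrow> (nat \<Rightarrow> nat) \<Rightarrow> real" where
  "Q_ICL k n A e = 1 / real n ^ 2 *
     (\<Sum>(a, b) \<in> {(a, b). a \<le> b \<and> b < k}.
        ln (Beta (otil n A e a b + 1/2) (ntil n e a b - otil n A e a b + 1/2) / Beta (1/2) (1/2)))"

definition Fset :: "nat \<Rightarrow> nat \<Rightarrow> real \<Rightarrow> (nat \<Rightarrow> nat) set" where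
  "Fset k n \<alpha> = {e. (\<forall>i<n. e i < k) \<and> (\<forall>i. n \<le> i \<longrightarrow> e i = 0) \<and> (\<forall>a<k. cnt n e a \<ge> \<alpha> * real n)}"

definition is_maximizer :: "(nat \<Rightarrow> nat \<Rightarrow> (nat \<Rightarrow> nat \<Rightarrow> bool) \<Rightarrow> (nat \<Rightarrow> nat) \<Rightarrow> real)
    \<Rightarrow> nat \<Rightarrow> (nat \<Rightarrow> real) \<Rightarrow> (nat \<Rightarrow> (nat \<Rightarrow> nat \<Rightarrow> bool) \<Rightarrow> nat \<Rightarrow> nat) \<Rightarrow> bool" where
  "is_maximizer Q k \<alpha> est \<longleftrightarrow>
     (\<forall>n A. Fset k n (\<alpha> n) \<noteq> {} \<longrightarrow>
        est n A \<in> Fset k n (\<alpha> n) \<and> (\<forall>e \<in> Fset k n (\<alpha> n). Q k n A e \<le> Q k n A (est n A)))"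

definition mismatch :: "nat \<Rightarrow> nat \<Rightarrow> (nat \<Rightarrow> nat) \<Rightarrow> (nat \<Rightarrow> nat) \<Rightarrow> nat" where
  "mismatch k n e z = Min {card {i. i < n \<and> e i \<noteq> \<sigma> (z i)} | \<sigma>. \<sigma> permutes {..<k}}"

definition weakly_consistent :: "nat pmf \<Rightarrow> (nat \<Rightarrow> nat \<Rightarrow> real) \<Rightarrow> (nat \<Rightarrow> real) \<Rightarrow> nat
    \<Rightarrow> (nat \<Rightarrow> (nat \<Rightarrow> nat \<Rightarrow> bool) \<Rightarrow> nat \<Rightarrow> nat) \<Rightarrow> bool" where
  "weakly_consistent p S \<rho> k est \<longleftrightarrow>
     (\<forall>\<epsilon>>0. (\<lambda>n. measure_pmf.prob (sbm p S \<rho> n)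
                  {(z, A). real (mismatch k n (est n A) z) < \<epsilon> * real n}) \<longlonglongrightarrow> 1)"

end

theory Submission
  imports Defs "HOL-Real_Asymp.Real_Asymp"
begin

text \<open>Conditionally on the labels, the number of edges in each block of a labelling concentrates: a
  multiplicative Chernoff bound beats the union bound over all \<open>k ^ n\<close> labellings because
  \<open>\<alpha>\<^sup>2 n \<rho> \<rightarrow> \<infinity>\<close>. As \<open>\<rho> \<rightarrow> 0\<close>, \<open>tau (\<rho> y) \<approx> \<rho> y (ln \<rho> - 1) + \<rho> y ln y\<close>, and the
  linear part sums to a function of the total number of edges, so both criteria reduce to maximizing the sum
  over blocks of \<open>N \<phi> (mean of S over the block)\<close>, where \<open>\<phi> y = y ln y\<close>. By Jensen the true labels
  maximize this sum, and strong convexity of \<open>\<phi>\<close> turns near-maximality into a small within-block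
  variance of \<open>S\<close>. Since \<open>S\<close> has no two identical columns, a small variance forces agreement with
  the true labels up to a permutation. The ICL criterion differs from the ML one only by a logarithmic
  term, by Stirling-type bounds.\<close>

subsection \<open>Convexity and Stirling-type estimates\<close>

text \<open>The factor \<open>ln \<rho> - 1\<close> of the linear part diverges, so replacing edge
  counts by their means there would cost \<open>\<eta> * |ln \<rho>|\<close> relative to the signal,
  which a fixed \<eta> does not control. Hence the linear part is never approximated: it keeps the
  observed counts, and only \<open>xlogx\<close>, Lipschitz on intervals away from 0, is moved from
  observed to expected densities. What remains has scale \<open>n^2 * \<rho>\<close>. On this scale
  there are three errors: the relative deviation \<eta>, a constant chosen after \<epsilon>; the
  quadratic remainder of \<open>tau\<close>, of relative size \<rho>; and the ICL correction, of
  order \<open>ln n / (n^2 * \<rho>)\<close>. The class-size floor \<alpha> acts on the estimated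
  blocks: each gets at least \<open>(\<alpha> n)^2 / 4\<close> pairs, and this size sets the
  exponent of the concentration bound. The matching with the true labels relies on the sizes of the
  true classes, which are of order n, so its threshold does not shrink with \<alpha>.\<close>

definition xlogx :: "real \<Rightarrow> real" where
  "xlogx x = x * ln x"

lemma xlogx_0 [simp]: "xlogx 0 = 0"
  by (simp add: xlogx_def)

text \<open>Applying \<open>ln x \<le> x - 1\<close> to \<open>sqrt (m / w)\<close> rather than to \<open>m / w\<close> is what gains the
  quadratic term.\<close>

lemma xlogx_strong_convex:
  assumes w: "0 < w" "w \<le> s" and m: "0 < m" "m \<le> s"
  shows "xlogx m + (1 + ln m) * (w - m) + (w - m)\<^sup>2 / (4 * s) \<le> xlogx w"
proof -
  define x y where "x = sqrt w" and "y = sqrt m"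
  have pos: "x > 0" "y > 0" and w_eq: "w = x\<^sup>2" and m_eq: "m = y\<^sup>2"
    using w m by (auto simp: x_def y_def)
  have "ln (y / x) \<le> y / x - 1"
    using pos by (intro ln_le_minus_one) auto
  then have "2 * x\<^sup>2 * (ln y - ln x) \<le> 2 * x\<^sup>2 * (y / x - 1)"
    using pos by (intro mult_left_mono) (auto simp: ln_div)
  also have "\<dots> = 2 * x * y - 2 * x\<^sup>2"
    using pos by (simp add: field_simps power2_eq_square)
  finally have "2 * x\<^sup>2 * ln x - 2 * x\<^sup>2 * ln y - x\<^sup>2 + y\<^sup>2 \<ge> (x - y)\<^sup>2"
    by (simp add: power2_eq_square algebra_simps)
  moreover have "(w - m)\<^sup>2 / (4 * s) \<le> (x - y)\<^sup>2"
  proof -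
    have "(x + y)\<^sup>2 \<le> 2 * (x\<^sup>2 + y\<^sup>2)"
      using zero_le_power2[of "x - y"] by (simp add: power2_eq_square algebra_simps)
    also have "\<dots> \<le> 4 * s"
      using w m by (simp flip: w_eq m_eq)
    finally have "(x - y)\<^sup>2 * (x + y)\<^sup>2 \<le> (x - y)\<^sup>2 * (4 * s)"
      by (intro mult_left_mono) auto
    moreover have "(x - y)\<^sup>2 * (x + y)\<^sup>2 = (w - m)\<^sup>2"
      by (simp add: w_eq m_eq power2_eq_square algebra_simps)
    ultimately show ?thesis
      using w by (simp add: field_simps)
  qed
  ultimately show ?thesis
    using pos by (simp add: xlogx_def w_eq m_eq ln_realpow algebra_simps)
qed

text \<open>Without its quadratic term, strong convexity is the tangent inequality at
  \<open>u\<close>, whose slope \<open>1 + ln u\<close> is bounded on the interval; exchanging the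
  two points gives the absolute value.\<close>

lemma xlogx_lipschitz:
  assumes "0 < a" "a \<le> x" "x \<le> b" "a \<le> y" "y \<le> b"
  shows "\<bar>xlogx x - xlogx y\<bar> \<le> (1 + \<bar>ln a\<bar> + \<bar>ln b\<bar>) * \<bar>x - y\<bar>"
proof -
  have ineq: "xlogx u - xlogx v \<le> (1 + \<bar>ln a\<bar> + \<bar>ln b\<bar>) * \<bar>u - v\<bar>"
    if "a \<le> u" "u \<le> b" "a \<le> v" "v \<le> b" for u v
  proof -
    have "0 \<le> (v - u)\<^sup>2 / (4 * b)"
      using assms by simp
    moreover have "xlogx u + (1 + ln u) * (v - u) + (v - u)\<^sup>2 / (4 * b) \<le> xlogx v"
      using that assms by (intro xlogx_strong_convex) auto
    ultimately have "xlogx u - xlogx v \<le> - ((1 + ln u) * (v - u))"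
      by linarith
    also have "\<dots> = (1 + ln u) * (u - v)"
      by (simp add: algebra_simps)
    finally have "xlogx u - xlogx v \<le> (1 + ln u) * (u - v)" .
    also have "\<dots> \<le> \<bar>1 + ln u\<bar> * \<bar>u - v\<bar>"
      by (simp flip: abs_mult)
    also have "\<dots> \<le> (1 + \<bar>ln a\<bar> + \<bar>ln b\<bar>) * \<bar>u - v\<bar>"
    proof (rule mult_right_mono)
      have "ln a \<le> ln u" "ln u \<le> ln b"
        using that assms by auto
      then show "\<bar>1 + ln u\<bar> \<le> 1 + \<bar>ln a\<bar> + \<bar>ln b\<bar>"
        by linarith
    qed auto
    finally show ?thesis .
  qed
  show ?thesis
    using ineq[of x y] ineq[of y x] assms by (simp add: abs_le_iff abs_minus_commute)
qed

text \<open>The term \<open>(1 - x) * ln (1 - x)\<close> lies between \<open>- x\<close> and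
  \<open>- x * (1 - x)\<close>, so it is \<open>- x\<close> up to \<open>x^2\<close>.\<close>

lemma tau_approx:
  assumes "0 < x" "x < 1"
  shows "\<bar>tau x - (xlogx x - x)\<bar> \<le> x\<^sup>2"
proof -
  have "ln (1 - x) \<le> - x"
    using assms ln_le_minus_one[of "1 - x"] by simp
  then have "(1 - x) * ln (1 - x) \<le> (1 - x) * (- x)"
    using assms by (intro mult_left_mono) auto
  moreover have "- ln (1 - x) \<le> 1 / (1 - x) - 1"
    using assms ln_le_minus_one[of "1 / (1 - x)"] by (simp add: ln_div)
  then have "(1 - x) * (- ln (1 - x)) \<le> (1 - x) * (1 / (1 - x) - 1)"
    using assms by (intro mult_left_mono) auto
  then have "- x \<le> (1 - x) * ln (1 - x)"
    using assms by (simp add: algebra_simps)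
  ultimately show ?thesis
    using assms by (simp add: tau_def xlogx_def power2_eq_square algebra_simps)
qed

text \<open>Here \<open>y\<close> is an observed density divided by \<rho> and \<open>v\<close> the
  corresponding mean of \<open>S\<close>. The linear term keeps \<open>y\<close> while
  \<open>xlogx\<close> already has \<open>v\<close>. The condition on \<eta> confines
  \<open>y\<close> to \<open>[s0 / 2, 2 * s1]\<close>, where the Lipschitz constant does not depend
  on \<rho>.\<close>

lemma tau_scaled_approx:
  assumes \<rho>: "0 < \<rho>" "2 * s1 * \<rho> < 1" and s: "0 < s0" "s0 \<le> v" "v \<le> s1"
    and y: "\<bar>y - v\<bar> \<le> \<eta>" and \<eta>: "\<eta> \<le> s0 / 2"
  shows "\<bar>tau (\<rho> * y) - ((ln \<rho> - 1) * (\<rho> * y) + \<rho> * xlogx v)\<bar>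
    \<le> \<rho> * ((1 + \<bar>ln (s0 / 2)\<bar> + \<bar>ln (2 * s1)\<bar>) * \<eta> + 4 * s1\<^sup>2 * \<rho>)"
proof -
  have y_bounds: "s0 / 2 \<le> y" "y \<le> 2 * s1"
    using assms by linarith+
  have y_pos: "0 < y"
    using y_bounds s by linarith
  have "\<rho> * y \<le> \<rho> * (2 * s1)"
    using y_bounds \<rho> by (intro mult_left_mono) auto
  also have "\<dots> < 1"
    using \<rho> by (simp add: mult_ac)
  finally have "\<rho> * y < 1" .
  then have "\<bar>tau (\<rho> * y) - (xlogx (\<rho> * y) - \<rho> * y)\<bar> \<le> (\<rho> * y)\<^sup>2"
    using \<rho> y_pos by (intro tau_approx) auto
  also have "\<dots> \<le> (\<rho> * (2 * s1))\<^sup>2"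
    using y_bounds y_pos \<rho> by (intro power_mono mult_left_mono) auto
  finally have 1: "\<bar>tau (\<rho> * y) - (xlogx (\<rho> * y) - \<rho> * y)\<bar> \<le> \<rho> * (4 * s1\<^sup>2 * \<rho>)"
    by (simp add: power2_eq_square mult_ac)
  have "\<bar>xlogx y - xlogx v\<bar> \<le> (1 + \<bar>ln (s0 / 2)\<bar> + \<bar>ln (2 * s1)\<bar>) * \<bar>y - v\<bar>"
    using y_bounds s by (intro xlogx_lipschitz) auto
  also have "\<dots> \<le> (1 + \<bar>ln (s0 / 2)\<bar> + \<bar>ln (2 * s1)\<bar>) * \<eta>"
    using y by (intro mult_left_mono) auto
  finally have "\<rho> * \<bar>xlogx y - xlogx v\<bar> \<le> \<rho> * ((1 + \<bar>ln (s0 / 2)\<bar> + \<bar>ln (2 * s1)\<bar>) * \<eta>)"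
    using \<rho> by (intro mult_left_mono) auto
  then have 2: "\<bar>\<rho> * xlogx y - \<rho> * xlogx v\<bar> \<le> \<rho> * ((1 + \<bar>ln (s0 / 2)\<bar> + \<bar>ln (2 * s1)\<bar>) * \<eta>)"
    using \<rho> by (simp add: abs_mult flip: right_diff_distrib)
  have "xlogx (\<rho> * y) - \<rho> * y = (ln \<rho> - 1) * (\<rho> * y) + \<rho> * xlogx y"
    using \<rho> y_pos by (simp add: xlogx_def ln_mult algebra_simps)
  with 1 2 show ?thesis
    by (simp add: distrib_left)
qed

text \<open>The increment of \<open>xlogx\<close> from n to n + 1 lies between
  \<open>ln n + 1\<close> and \<open>ln (n + 1) + 1\<close>, by \<open>ln x \<le> x - 1\<close> at
  the ratios of n and n + 1; both bounds follow by telescoping. At n = 0 the convention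
  \<open>ln 0 = 0\<close> applies.\<close>

lemma ln_fact_bounds:
  shows "xlogx (real n) - real n \<le> ln (fact n)"
    and "ln (fact n) \<le> xlogx (real n) - real n + ln (real n) + 1"
proof -
  show "xlogx (real n) - real n \<le> ln (fact n)"
  proof (induction n)
    case (Suc n)
    have "xlogx (real (Suc n)) - xlogx (real n) - 1 \<le> ln (real (Suc n))"
    proof (cases "n = 0")
      case False
      then have n: "real n > 0" by simp
      have "ln (real (Suc n) / real n) \<le> real (Suc n) / real n - 1"
        using n by (intro ln_le_minus_one) auto
      then have "real n * ln (real (Suc n) / real n) \<le> real n * (real (Suc n) / real n - 1)"
        using n by (intro mult_left_mono) auto
      then have "real n * (ln (real (Suc n)) - ln (real n)) \<le> 1"
        using n by (simp add: ln_div right_diff_distrib)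
      then show ?thesis
        by (simp add: xlogx_def algebra_simps)
    qed (simp add: xlogx_def)
    moreover have "ln (fact (Suc n)) = ln (real (Suc n)) + ln (fact n :: real)"
      by (simp add: ln_mult del: of_nat_Suc)
    ultimately show ?case
      using Suc by simp
  qed simp
  show "ln (fact n) \<le> xlogx (real n) - real n + ln (real n) + 1"
  proof (induction n)
    case (Suc n)
    have "xlogx (real n) + ln (real n) + 1 \<le> xlogx (real (Suc n))" if "n \<noteq> 0"
    proof -
      have n: "real n > 0" using that by simp
      have "ln (real n / real (Suc n)) \<le> real n / real (Suc n) - 1"
        using n by (intro ln_le_minus_one) auto
      then have "real (Suc n) * ln (real n / real (Suc n)) \<le> real (Suc n) * (real n / real (Suc n) - 1)"
        by (intro mult_left_mono) auto
      then have "real (Suc n) * (ln (real n) - ln (real (Suc n))) \<le> - 1"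
        using n by (simp add: ln_div right_diff_distrib)
      then show ?thesis
        by (simp add: xlogx_def algebra_simps)
    qed
    moreover have "ln (fact (Suc n)) = ln (real (Suc n)) + ln (fact n :: real)"
      by (simp add: ln_mult del: of_nat_Suc)
    ultimately show ?case
      using Suc by (cases "n = 0") (auto simp: xlogx_def)
  qed simp
qed

text \<open>The quotient of the two sides is the central binomial coefficient over
  \<open>4 ^ m\<close>, of true order \<open>1 / sqrt m\<close>. A polynomial loss suffices, as only
  logarithms are compared later.\<close>

lemma pochhammer_half_bounds:
  "pochhammer (1 / 2) m \<le> (fact m :: real)" "fact m \<le> real (2 * m + 1) * pochhammer (1 / 2) m"
proof -
  show "pochhammer (1 / 2) m \<le> (fact m :: real)"
  proof (induction m)
    case (Suc m)
    have "pochhammer (1 / 2) m * (1 / 2 + real m) \<le> fact m * (real m + 1)"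
      using Suc by (intro mult_mono) auto
    then show ?case
      by (simp add: pochhammer_rec' algebra_simps)
  qed simp
  show "fact m \<le> real (2 * m + 1) * pochhammer (1 / 2) m"
  proof (induction m)
    case (Suc m)
    have p: "pochhammer (1 / 2) m > (0 :: real)"
      by (intro pochhammer_pos) auto
    have "fact (Suc m) = (real m + 1) * fact m"
      by simp
    also have "\<dots> \<le> (real m + 1) * (real (2 * m + 1) * pochhammer (1 / 2) m)"
      using Suc by (intro mult_left_mono) auto
    also have "\<dots> = (2 * real m + 2) * pochhammer (1 / 2) (Suc m)"
      by (simp add: pochhammer_rec' algebra_simps)
    also have "\<dots> \<le> real (2 * Suc m + 1) * pochhammer (1 / 2) (Suc m)"
      using pochhammer_pos[of "1/2 :: real" "Suc m"] by (intro mult_right_mono) auto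
    finally show ?case .
  qed simp
qed

text \<open>This is the Krichevsky-Trofimov probability of a binary sequence of length N with m
  ones: the Bernoulli likelihood averaged over the Jeffreys prior. The normalization by
  \<open>Beta (1 / 2) (1 / 2)\<close> cancels all factors \<open>Gamma (1 / 2)\<close>.\<close>

lemma Beta_half_ratio:
  assumes "m \<le> N"
  shows "Beta (real m + 1 / 2) (real N - real m + 1 / 2) / Beta (1 / 2) (1 / 2 :: real)
    = pochhammer (1 / 2) m * pochhammer (1 / 2) (N - m) / fact N"
proof -
  have "(1 / 2 :: real) \<notin> \<int>\<^sub>\<le>\<^sub>0"
    using nonpos_Ints_nonpos[of "1/2 :: real"] by auto
  then have poch: "pochhammer (1 / 2) i = Gamma (1 / 2 + real i) / Gamma (1 / 2 :: real)" for i
    by (rule pochhammer_Gamma)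
  have "Gamma (1 / 2 :: real) \<noteq> 0"
    using Gamma_real_pos[of "1/2 :: real"] by linarith
  moreover have "Gamma (real N + 1) = fact N"
    using Gamma_fact[of N, where 'a = real] by (simp add: add.commute)
  moreover have "Gamma (real m + 1 / 2 + (real N - real m + 1 / 2)) = Gamma (real N + 1)"
    by (simp add: add.commute)
  moreover have eqs: "1 / 2 + real (N - m) = real N - real m + 1 / 2" "1 / 2 + real m = real m + 1 / 2"
    using assms by (simp_all add: of_nat_diff)
  moreover have "Gamma (1 / 2 + 1 / 2 :: real) = 1"
    by simp
  ultimately show ?thesis
    unfolding Beta_def poch eqs by simp
qed

text \<open>\<open>N * tau (m / N)\<close> is the maximized Bernoulli log-likelihood; averaging the
  likelihood instead of maximizing it costs only a logarithm.\<close>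

lemma ln_Beta_approx:
  assumes "m \<le> N" "0 < N"
  shows "\<bar>ln (Beta (real m + 1 / 2) (real N - real m + 1 / 2) / Beta (1 / 2) (1 / 2))
      - real N * tau (real m / real N)\<bar> \<le> 2 + 3 * ln (2 * real N + 1)"
proof -
  define l where "l = N - m"
  have N: "real N = real m + real l"
    using assms by (simp add: l_def)
  have poch: "ln (pochhammer (1 / 2) i) \<le> ln (fact i :: real)"
    "ln (fact i :: real) \<le> ln (2 * real N + 1) + ln (pochhammer (1 / 2) i)" if "i \<le> N" for i
  proof -
    have p: "pochhammer (1 / 2) i > (0 :: real)"
      by (intro pochhammer_pos) auto
    show "ln (pochhammer (1 / 2) i) \<le> ln (fact i :: real)"
      using pochhammer_half_bounds(1)[of i] p by simp
    have "real (2 * i + 1) * pochhammer (1 / 2) i \<le> (2 * real N + 1) * pochhammer (1 / 2) i"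
      using that p by (intro mult_right_mono) auto
    then have "fact i \<le> (2 * real N + 1) * pochhammer (1 / 2) i"
      using pochhammer_half_bounds(2)[of i] by linarith
    then have "ln (fact i :: real) \<le> ln ((2 * real N + 1) * pochhammer (1 / 2) i)"
      using p by simp
    then show "ln (fact i :: real) \<le> ln (2 * real N + 1) + ln (pochhammer (1 / 2) i)"
      using p by (simp add: ln_mult)
  qed
  have ln_mono: "ln (real i) \<le> ln (2 * real N + 1)" if "i \<le> N" for i
    using that by (cases "i = 0") auto
  have tau: "real N * tau (real m / real N) = xlogx (real m) + xlogx (real l) - xlogx (real N)"
  proof (cases "m = 0 \<or> l = 0")
    case True
    then show ?thesis
      using assms N by (auto simp: tau_def)
  next
    case False
    then have bounds: "0 < real m / real N" "real m / real N < 1"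
      using N assms by (auto simp: field_simps)
    have tau_eq: "tau x = x * ln x + (1 - x) * ln (1 - x)" if "0 < x" "x < 1" for x
      using that by (simp add: tau_def)
    have compl: "1 - real m / real N = real l / real N"
      using N assms by (simp add: field_simps)
    have "tau (real m / real N)
        = real m / real N * ln (real m / real N) + real l / real N * ln (real l / real N)"
      using tau_eq[OF bounds] unfolding compl .
    then have "real N * tau (real m / real N)
        = real m * ln (real m / real N) + real l * ln (real l / real N)"
      using assms by (simp add: distrib_left)
    moreover have "ln (real m / real N) = ln (real m) - ln (real N)"
      "ln (real l / real N) = ln (real l) - ln (real N)"
      using False assms by (auto intro: ln_divide_pos)
    moreover have "xlogx (real N) = real m * ln (real N) + real l * ln (real N)"
      unfolding xlogx_def by (simp only: N distrib_right)
    ultimately show ?thesis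
      by (simp only: right_diff_distrib xlogx_def)
  qed
  \<comment> \<open>The linear Stirling terms \<open>M\<close> and \<open>K\<close> cancel because N
    = m + l. The upper estimate costs \<open>2 + 2 * L\<close>, the lower one
    \<open>1 + 3 * L\<close>; the stated constant covers both.\<close>
  have arith: "\<bar>pm + pl - fN - (xm + xl - xN)\<bar> \<le> 2 + 3 * L"
    if "pm \<le> fm" "fm \<le> L + pm" "pl \<le> fl" "fl \<le> L + pl" "0 \<le> L"
      "xm - M \<le> fm" "fm \<le> xm - M + lm + 1" "xl - K \<le> fl" "fl \<le> xl - K + ll + 1"
      "xN - (M + K) \<le> fN" "fN \<le> xN - (M + K) + lN + 1" "lm \<le> L" "ll \<le> L" "lN \<le> L"
    for pm pl fm fl fN xm xl xN L lm ll lN M K :: real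
  proof (rule abs_leI)
    have "pm \<le> xm - M + L + 1" "pl \<le> xl - K + L + 1"
      using that(1,2,7,12) that(3,4,9,13) by simp_all
    then have "pm + pl - fN - (xm + xl - xN) \<le> 2 + 2 * L"
      using that(10) by simp
    then show "pm + pl - fN - (xm + xl - xN) \<le> 2 + 3 * L"
      using that(5) by simp
    have "xm - M - L \<le> pm" "xl - K - L \<le> pl"
      using that(2,6) that(4,8) by simp_all
    then show "- (pm + pl - fN - (xm + xl - xN)) \<le> 2 + 3 * L"
      using that(5,11,14) by simp
  qed
  have KT: "ln (Beta (real m + 1 / 2) (real N - real m + 1 / 2) / Beta (1 / 2) (1 / 2))
      = ln (pochhammer (1 / 2) m) + ln (pochhammer (1 / 2) l) - ln (fact N :: real)"
    using assms pochhammer_pos[of "1/2 :: real" m] pochhammer_pos[of "1/2 :: real" l]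
    by (simp add: Beta_half_ratio ln_div ln_mult l_def)
  have le: "m \<le> N" "l \<le> N"
    using assms by (auto simp: l_def)
  have fN: "xlogx (real N) - (real m + real l) \<le> ln (fact N)"
    "ln (fact N) \<le> xlogx (real N) - (real m + real l) + ln (real N) + 1"
    using ln_fact_bounds[of N] by (simp_all only: N[symmetric])
  show ?thesis
    unfolding KT tau
    by (rule arith[OF poch[OF le(1)] poch[OF le(2)] _ ln_fact_bounds[of m] ln_fact_bounds[of l]
        fN ln_mono[OF le(1)] ln_mono[OF le(2)] ln_mono[OF order.refl]]) simp
qed

subsection \<open>Block profiles\<close>

definition cell_sum :: "'p set \<Rightarrow> ('p \<Rightarrow> 'u) \<Rightarrow> ('p \<Rightarrow> real) \<Rightarrow> 'u \<Rightarrow> real" where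
  "cell_sum P c f u = (\<Sum>p\<in>{p \<in> P. c p = u}. f p)"

lemma sum_cell_sum:
  assumes "finite P" "finite U" "c ` P \<subseteq> U"
  shows "(\<Sum>u\<in>U. cell_sum P c f u) = (\<Sum>p\<in>P. f p)"
  unfolding cell_sum_def using assms by (intro sum.group) auto

lemma cell_sum_mean_bounds:
  assumes "finite P" "\<And>p. p \<in> P \<Longrightarrow> w p \<in> {s0..s1}" "cell_sum P c (\<lambda>_. 1) u > 0"
  shows "cell_sum P c w u / cell_sum P c (\<lambda>_. 1) u \<in> {s0..s1}"
proof -
  have "(\<Sum>p\<in>{p \<in> P. c p = u}. s0) \<le> cell_sum P c w u"
    unfolding cell_sum_def by (intro sum_mono) (use assms in auto)
  moreover have "cell_sum P c w u \<le> (\<Sum>p\<in>{p \<in> P. c p = u}. s1)"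
    unfolding cell_sum_def by (intro sum_mono) (use assms in auto)
  ultimately show ?thesis
    using assms(3) by (simp add: cell_sum_def pos_le_divide_eq pos_divide_le_eq mult.commute)
qed

text \<open>With \<open>b\<close> the edge indicators, each summand is the maximized Bernoulli
  log-likelihood of one cell; an empty cell contributes 0.\<close>

definition profile :: "'p set \<Rightarrow> 'u set \<Rightarrow> ('p \<Rightarrow> real) \<Rightarrow> ('p \<Rightarrow> 'u) \<Rightarrow> real" where
  "profile P U b c = (\<Sum>u\<in>U. cell_sum P c (\<lambda>_. 1) u * tau (cell_sum P c b u / cell_sum P c (\<lambda>_. 1) u))"

text \<open>The part of the profile that is linear in \<open>b\<close> does not depend on the partition \<open>c\<close>.\<close>

lemma profile_expansion:
  fixes w b :: "'p \<Rightarrow> real" and c :: "'p \<Rightarrow> 'u"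
  assumes P: "finite P" "finite U" "c ` P \<subseteq> U"
    and w: "\<And>p. p \<in> P \<Longrightarrow> w p \<in> {s0..s1}" and s0: "0 < s0"
    and \<rho>: "0 < \<rho>" "2 * s1 * \<rho> < 1" and \<eta>: "\<eta> \<le> s0 / 2"
    and conc: "\<And>u. u \<in> U \<Longrightarrow> \<bar>cell_sum P c b u - \<rho> * cell_sum P c w u\<bar> \<le> \<eta> * \<rho> * cell_sum P c (\<lambda>_. 1) u"
  shows "\<bar>profile P U b c - ((ln \<rho> - 1) * (\<Sum>p\<in>P. b p) + \<rho> *
      (\<Sum>u\<in>U. cell_sum P c (\<lambda>_. 1) u * xlogx (cell_sum P c w u / cell_sum P c (\<lambda>_. 1) u)))\<bar>
    \<le> \<rho> * real (card P) * ((1 + \<bar>ln (s0 / 2)\<bar> + \<bar>ln (2 * s1)\<bar>) * \<eta> + 4 * s1\<^sup>2 * \<rho>)"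
proof -
  define N where "N = cell_sum P c (\<lambda>_. 1)"
  define O' where "O' = cell_sum P c b"
  define W where "W = cell_sum P c w"
  define err where "err = (1 + \<bar>ln (s0 / 2)\<bar> + \<bar>ln (2 * s1)\<bar>) * \<eta> + 4 * s1\<^sup>2 * \<rho>"
  have cell: "\<bar>N u * tau (O' u / N u) - ((ln \<rho> - 1) * O' u + \<rho> * (N u * xlogx (W u / N u)))\<bar>
      \<le> \<rho> * N u * err" if u: "u \<in> U" for u
  proof (cases "N u = 0")
    case True
    then have "{p \<in> P. c p = u} = {}"
      using P by (simp add: N_def cell_sum_def)
    then have "O' u = 0"
      unfolding O'_def cell_sum_def by (simp only: sum.empty)
    with True show ?thesis by simp
  next
    case False
    then have N: "N u > 0"
      by (simp add: N_def cell_sum_def card_gt_0_iff)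
    define y where "y = O' u / (\<rho> * N u)"
    have "\<bar>O' u - \<rho> * W u\<bar> \<le> \<eta> * \<rho> * N u"
      using conc[OF u] by (simp add: O'_def W_def N_def)
    then have "\<bar>O' u - \<rho> * W u\<bar> / (\<rho> * N u) \<le> \<eta>"
      using \<rho> N by (simp add: field_simps)
    moreover have "y - W u / N u = (O' u - \<rho> * W u) / (\<rho> * N u)"
      using \<rho> N by (simp add: y_def field_simps)
    ultimately have "\<bar>y - W u / N u\<bar> \<le> \<eta>"
      using \<rho> N by simp
    moreover have "W u / N u \<in> {s0..s1}"
      unfolding W_def N_def using P w N by (intro cell_sum_mean_bounds) (auto simp: N_def)
    ultimately have "\<bar>tau (\<rho> * y) - ((ln \<rho> - 1) * (\<rho> * y) + \<rho> * xlogx (W u / N u))\<bar> \<le> \<rho> * err"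
      unfolding err_def using s0 \<rho> \<eta> by (intro tau_scaled_approx) auto
    then have "N u * \<bar>tau (\<rho> * y) - ((ln \<rho> - 1) * (\<rho> * y) + \<rho> * xlogx (W u / N u))\<bar> \<le> N u * (\<rho> * err)"
      using N by (intro mult_left_mono) auto
    then have "\<bar>N u * (tau (\<rho> * y) - ((ln \<rho> - 1) * (\<rho> * y) + \<rho> * xlogx (W u / N u)))\<bar> \<le> N u * (\<rho> * err)"
      using N by (simp add: abs_mult)
    moreover define r where "r = O' u / N u"
    moreover have "\<rho> * y = r" and O': "O' u = N u * r"
      using \<rho> N by (auto simp: y_def r_def)
    ultimately show ?thesis
      unfolding r_def[symmetric] unfolding O' by (simp add: algebra_simps)
  qed
  have "profile P U b c - ((ln \<rho> - 1) * (\<Sum>p\<in>P. b p) + \<rho> * (\<Sum>u\<in>U. N u * xlogx (W u / N u)))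
      = (\<Sum>u\<in>U. N u * tau (O' u / N u) - ((ln \<rho> - 1) * O' u + \<rho> * (N u * xlogx (W u / N u))))"
    using sum_cell_sum[OF P, of b]
    by (simp add: profile_def N_def O'_def sum.distrib sum_subtractf flip: sum_distrib_left)
  also have "\<bar>\<dots>\<bar> \<le> (\<Sum>u\<in>U. \<rho> * N u * err)"
    using cell by (intro order.trans[OF sum_abs] sum_mono) auto
  also have "\<dots> = \<rho> * real (card P) * err"
    using sum_cell_sum[OF P, of "\<lambda>_. 1"]
    by (simp add: N_def flip: sum_distrib_left sum_distrib_right)
  finally show ?thesis
    by (simp add: N_def W_def err_def)
qed

text \<open>Strong convexity is applied at the mean of each cell and summed. The tangent terms
  vanish, since their slope is constant on a cell and deviations from the cell mean sum to 0; the
  quadratic terms are what is left of Jensen's inequality.\<close>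

lemma xlogx_jensen_gap:
  fixes w :: "'p \<Rightarrow> real" and c :: "'p \<Rightarrow> 'u"
  assumes P: "finite P" "finite U" "c ` P \<subseteq> U"
    and w: "\<And>p. p \<in> P \<Longrightarrow> w p \<in> {s0..s1}" and s0: "0 < s0"
  shows "(\<Sum>p\<in>P. (w p - cell_sum P c w (c p) / cell_sum P c (\<lambda>_. 1) (c p))\<^sup>2) / (4 * s1)
    \<le> (\<Sum>p\<in>P. xlogx (w p))
      - (\<Sum>u\<in>U. cell_sum P c (\<lambda>_. 1) u * xlogx (cell_sum P c w u / cell_sum P c (\<lambda>_. 1) u))"
proof -
  define N where "N = cell_sum P c (\<lambda>_. 1)"
  define m where "m = (\<lambda>u. cell_sum P c w u / N u)"
  have N_pos: "N (c p) > 0" if "p \<in> P" for p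
    using that P by (auto simp: N_def cell_sum_def card_gt_0_iff)
  have m: "m (c p) \<in> {s0..s1}" if "p \<in> P" for p
    unfolding m_def N_def using P w N_pos[OF that] by (intro cell_sum_mean_bounds) (auto simp: N_def)
  have linear: "cell_sum P c (\<lambda>p. g u * (w p - m u)) u = 0" for u and g :: "'u \<Rightarrow> real"
  proof (cases "N u = 0")
    case True
    then have "{p \<in> P. c p = u} = {}"
      using P by (simp add: N_def cell_sum_def)
    then show ?thesis
      unfolding cell_sum_def by (simp only: sum.empty)
  next
    case False
    have "cell_sum P c (\<lambda>p. g u * (w p - m u)) u = g u * (cell_sum P c w u - N u * m u)"
      by (simp add: cell_sum_def N_def sum_subtractf flip: sum_distrib_left)
    with False show ?thesis
      by (simp add: m_def)
  qed
  have "(\<Sum>p\<in>P. xlogx (m (c p))) = (\<Sum>u\<in>U. cell_sum P c (\<lambda>p. xlogx (m (c p))) u)"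
    using sum_cell_sum[OF P] by metis
  also have "\<dots> = (\<Sum>u\<in>U. N u * xlogx (m u))"
    by (simp add: cell_sum_def N_def)
  finally have const: "(\<Sum>p\<in>P. xlogx (m (c p))) = (\<Sum>u\<in>U. N u * xlogx (m u))" .
  have "(\<Sum>p\<in>P. (1 + ln (m (c p))) * (w p - m (c p)))
      = (\<Sum>u\<in>U. cell_sum P c (\<lambda>p. (1 + ln (m (c p))) * (w p - m (c p))) u)"
    using sum_cell_sum[OF P] by metis
  also have "\<dots> = (\<Sum>u\<in>U. cell_sum P c (\<lambda>p. (1 + ln (m u)) * (w p - m u)) u)"
    by (simp add: cell_sum_def)
  also have "\<dots> = 0"
    using linear[of "\<lambda>u. 1 + ln (m u)"] by simp
  finally have lin: "(\<Sum>p\<in>P. (1 + ln (m (c p))) * (w p - m (c p))) = 0" .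
  have "(\<Sum>p\<in>P. xlogx (m (c p)) + (1 + ln (m (c p))) * (w p - m (c p)) + (w p - m (c p))\<^sup>2 / (4 * s1))
      \<le> (\<Sum>p\<in>P. xlogx (w p))"
  proof (intro sum_mono xlogx_strong_convex)
    fix p assume p: "p \<in> P"
    show "0 < w p" "w p \<le> s1" "0 < m (c p)" "m (c p) \<le> s1"
      using w[OF p] m[OF p] s0 by auto
  qed
  then show ?thesis
    unfolding sum.distrib lin const sum_divide_distrib[symmetric] by (simp add: N_def m_def)
qed

subsection \<open>A multiplicative Chernoff bound\<close>

text \<open>For negative \<open>x\<close>, \<open>(1 + x + x^2) * (1 - x) = 1 - x^3\<close> is at
  least 1, and \<open>1 - x \<le> exp (- x)\<close>.\<close>

lemma exp_le_quadratic:
  fixes x :: real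
  assumes "\<bar>x\<bar> \<le> 1"
  shows "exp x \<le> 1 + x + x\<^sup>2"
proof (cases "x \<ge> 0")
  case False
  have "1 * exp x \<le> (1 + x + x\<^sup>2) * (1 - x) * exp x"
  proof (rule mult_right_mono)
    have "x ^ 3 \<le> 0"
      using False by (simp add: power3_eq_cube mult_nonneg_nonpos zero_le_mult_iff)
    then show "1 \<le> (1 + x + x\<^sup>2) * (1 - x)"
      by (simp add: power2_eq_square power3_eq_cube algebra_simps)
  qed auto
  also have "\<dots> \<le> (1 + x + x\<^sup>2) * exp (- x) * exp x"
    using exp_ge_add_one_self[of "- x"] assms
    by (intro mult_right_mono mult_left_mono) (auto intro!: add_nonneg_nonneg)
  also have "\<dots> = 1 + x + x\<^sup>2"
    by (simp add: mult.assoc flip: exp_add)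
  finally show ?thesis by simp
qed (use assms in \<open>auto intro: exp_bound\<close>)

text \<open>In contrast to Hoeffding's bound, the quadratic term carries the success probability.
  This brings the factor \<rho> into the variance proxy for sparse edges.\<close>

lemma bernoulli_mgf_bound:
  fixes Q :: "'b pmf" and E :: "'b set"
  assumes "\<bar>t\<bar> \<le> 1"
  shows "measure_pmf.expectation Q (\<lambda>x. exp (t * of_bool (x \<in> E))) \<le> exp ((t + t\<^sup>2) * measure_pmf.prob Q E)"
proof -
  have "measure_pmf.expectation Q (\<lambda>x. exp (t * of_bool (x \<in> E)))
      = measure_pmf.expectation Q (\<lambda>x. 1 + (exp t - 1) * indicator E x)"
    by (intro Bochner_Integration.integral_cong) (auto simp: indicator_def)
  also have "\<dots> = 1 + (exp t - 1) * measure_pmf.prob Q E"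
    by (subst Bochner_Integration.integral_add) (auto simp: measure_pmf.emeasure_eq_measure)
  also have "\<dots> \<le> exp ((exp t - 1) * measure_pmf.prob Q E)"
    by (rule exp_ge_add_one_self)
  also have "\<dots> \<le> exp ((t + t\<^sup>2) * measure_pmf.prob Q E)"
    using exp_le_quadratic[OF assms] by (simp add: mult_right_mono)
  finally show ?thesis .
qed

text \<open>Exponential Markov inequality, with \<open>s\<close> selecting the tail. The events
  \<open>E x\<close> are general because the bound serves both edges (\<open>{True}\<close>) and
  label counts (\<open>{a}\<close>).\<close>

lemma chernoff_one_sided:
  fixes D :: "'a \<Rightarrow> 'b pmf" and E :: "'a \<Rightarrow> 'b set" and l :: real
  assumes A: "finite A" "C \<subseteq> A" and s: "s = 1 \<or> s = -1" and l: "0 \<le> l" "l \<le> 1"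
  shows "measure_pmf.prob (Pi_pmf A d D)
      {B. s * ((\<Sum>x\<in>C. of_bool (B x \<in> E x)) - (\<Sum>x\<in>C. measure_pmf.prob (D x) (E x))) \<ge> r}
    \<le> exp (l\<^sup>2 * (\<Sum>x\<in>C. measure_pmf.prob (D x) (E x)) - l * r)"
proof -
  define q where "q = (\<lambda>x. measure_pmf.prob (D x) (E x))"
  define t where "t = s * l"
  have t: "\<bar>t\<bar> \<le> 1" "t\<^sup>2 = l\<^sup>2"
    using s l by (auto simp: t_def)
  have C: "finite C"
    using A finite_subset by blast
  \<comment> \<open>Coordinates outside \<open>C\<close> get the factor 1, so that the exponential
    is a product over all of \<open>A\<close> and its expectation factorizes.\<close>
  define h where "h = (\<lambda>x y. if x \<in> C then exp (t * of_bool (y \<in> E x)) else 1 :: real)"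
  define u where "u = (\<lambda>B. exp (t * (\<Sum>x\<in>C. of_bool (B x \<in> E x))))"
  have u_eq: "u = (\<lambda>B. \<Prod>x\<in>A. h x (B x))"
  proof
    fix B
    have "(\<Prod>x\<in>A. h x (B x)) = (\<Prod>x\<in>C. exp (t * of_bool (B x \<in> E x)))"
      using A C unfolding h_def by (subst prod.inter_restrict[symmetric]) (auto simp: Int_absorb1)
    also have "\<dots> = u B"
      unfolding u_def sum_distrib_left exp_sum[OF C] ..
    finally show "u B = (\<Prod>x\<in>A. h x (B x))" by simp
  qed
  have h_bounds: "0 \<le> h x y" "h x y \<le> exp \<bar>t\<bar>" for x y
    by (auto simp: h_def)
  have h_int: "integrable (measure_pmf (D x)) (h x)" for x
    using h_bounds by (intro measure_pmf.integrable_const_bound[where B = "exp \<bar>t\<bar>"]) auto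
  have u_int: "integrable (measure_pmf (Pi_pmf A d D)) u"
    unfolding u_eq using h_int h_bounds A by (intro integrable_prod_Pi_pmf) auto
  have "measure_pmf.expectation (Pi_pmf A d D) u = (\<Prod>x\<in>A. measure_pmf.expectation (D x) (h x))"
    unfolding u_eq using h_int h_bounds A by (intro expectation_prod_Pi_pmf) auto
  also have "\<dots> \<le> (\<Prod>x\<in>A. exp (if x \<in> C then (t + l\<^sup>2) * q x else 0))"
    using bernoulli_mgf_bound[OF t(1)] h_bounds t(2)
    by (intro prod_mono) (auto simp: h_def q_def intro!: Bochner_Integration.integral_nonneg)
  also have "\<dots> = exp ((t + l\<^sup>2) * (\<Sum>x\<in>C. q x))"
    using A C by (simp add: exp_sum[symmetric] sum.inter_restrict[symmetric] Int_absorb1 sum_distrib_left)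
  finally have exp_u: "measure_pmf.expectation (Pi_pmf A d D) u \<le> exp ((t + l\<^sup>2) * (\<Sum>x\<in>C. q x))" .
  have "measure_pmf.prob (Pi_pmf A d D)
      {B. s * ((\<Sum>x\<in>C. of_bool (B x \<in> E x)) - (\<Sum>x\<in>C. q x)) \<ge> r}
    \<le> measure_pmf.prob (Pi_pmf A d D) {B \<in> space (measure_pmf (Pi_pmf A d D)). u B \<ge> exp (l * r + t * (\<Sum>x\<in>C. q x))}"
  proof (intro measure_pmf.finite_measure_mono subsetI)
    fix B assume "B \<in> {B. s * ((\<Sum>x\<in>C. of_bool (B x \<in> E x)) - (\<Sum>x\<in>C. q x)) \<ge> r}"
    then have "l * r \<le> l * (s * ((\<Sum>x\<in>C. of_bool (B x \<in> E x)) - (\<Sum>x\<in>C. q x)))"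
      using l by (intro mult_left_mono) auto
    then show "B \<in> {B \<in> space (measure_pmf (Pi_pmf A d D)). u B \<ge> exp (l * r + t * (\<Sum>x\<in>C. q x))}"
      by (simp add: u_def t_def algebra_simps)
  qed auto
  also have "\<dots> \<le> measure_pmf.expectation (Pi_pmf A d D) u / exp (l * r + t * (\<Sum>x\<in>C. q x))"
    using u_int by (intro integral_Markov_inequality_measure[where A = UNIV]) (auto simp: u_def)
  also have "\<dots> \<le> exp ((t + l\<^sup>2) * (\<Sum>x\<in>C. q x)) / exp (l * r + t * (\<Sum>x\<in>C. q x))"
    using exp_u by (intro divide_right_mono) auto
  also have "\<dots> = exp (l\<^sup>2 * (\<Sum>x\<in>C. q x) - l * r)"
    by (simp add: exp_diff[symmetric] algebra_simps)
  finally show ?thesis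
    by (simp add: q_def)
qed

text \<open>The choice \<open>l = \<eta> / 2\<close> minimizes
  \<open>l^2 * M - l * \<eta> * M\<close>, and \<open>\<eta> \<le> 2\<close> keeps it at most 1.
  Since \<open>M\<close> only has to dominate the mean, it can be taken as a constant multiple of a
  block size.\<close>

lemma chernoff:
  fixes D :: "'a \<Rightarrow> 'b pmf" and E :: "'a \<Rightarrow> 'b set" and M \<eta> :: real
  assumes A: "finite A" "C \<subseteq> A" and M: "0 < M" "(\<Sum>x\<in>C. measure_pmf.prob (D x) (E x)) \<le> M"
    and \<eta>: "0 < \<eta>" "\<eta> \<le> 2"
  shows "measure_pmf.prob (Pi_pmf A d D)
      {B. \<bar>(\<Sum>x\<in>C. of_bool (B x \<in> E x)) - (\<Sum>x\<in>C. measure_pmf.prob (D x) (E x))\<bar> \<ge> \<eta> * M}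
    \<le> 2 * exp (- (\<eta>\<^sup>2 * M / 4))"
proof -
  define X where "X = (\<lambda>B. (\<Sum>x\<in>C. of_bool (B x \<in> E x)) - (\<Sum>x\<in>C. measure_pmf.prob (D x) (E x)))"
  have one: "measure_pmf.prob (Pi_pmf A d D) {B. s * X B \<ge> \<eta> * M} \<le> exp (- (\<eta>\<^sup>2 * M / 4))"
    if "s = 1 \<or> s = -1" for s
  proof -
    have "measure_pmf.prob (Pi_pmf A d D) {B. s * X B \<ge> \<eta> * M}
        \<le> exp ((\<eta> / 2)\<^sup>2 * (\<Sum>x\<in>C. measure_pmf.prob (D x) (E x)) - (\<eta> / 2) * (\<eta> * M))"
      unfolding X_def using A that \<eta> by (intro chernoff_one_sided) auto
    also have "\<dots> \<le> exp ((\<eta> / 2)\<^sup>2 * M - (\<eta> / 2) * (\<eta> * M))"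
      using M by (simp add: mult_left_mono)
    also have "(\<eta> / 2)\<^sup>2 * M - (\<eta> / 2) * (\<eta> * M) = - (\<eta>\<^sup>2 * M / 4)"
      by (simp add: power2_eq_square field_simps)
    finally show ?thesis .
  qed
  have "measure_pmf.prob (Pi_pmf A d D) {B. \<bar>X B\<bar> \<ge> \<eta> * M}
      \<le> measure_pmf.prob (Pi_pmf A d D) ({B. 1 * X B \<ge> \<eta> * M} \<union> {B. (- 1) * X B \<ge> \<eta> * M})"
    by (intro measure_pmf.finite_measure_mono) (auto simp: abs_if split: if_splits)
  also have "\<dots> \<le> measure_pmf.prob (Pi_pmf A d D) {B. 1 * X B \<ge> \<eta> * M}
      + measure_pmf.prob (Pi_pmf A d D) {B. (- 1) * X B \<ge> \<eta> * M}"
    by (intro measure_Un_le) auto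
  finally show ?thesis
    using one[of 1] one[of "-1"] by (simp add: X_def)
qed

subsection \<open>Pairs of nodes and blocks of a labelling\<close>

definition pairs :: "nat \<Rightarrow> (nat \<times> nat) set" where
  "pairs n = {(i, j). i < j \<and> j < n}"

text \<open>Sorting the labels identifies the blocks (a, b) and (b, a), which share one edge
  parameter.\<close>

definition block :: "(nat \<Rightarrow> nat) \<Rightarrow> nat \<times> nat \<Rightarrow> nat \<times> nat" where
  "block e = (\<lambda>(i, j). (min (e i) (e j), max (e i) (e j)))"

definition blocks :: "nat \<Rightarrow> (nat \<times> nat) set" where
  "blocks k = {(a, b). a \<le> b \<and> b < k}"

lemma pairs_Suc: "pairs (Suc n) = pairs n \<union> (\<lambda>i. (i, n)) ` {..<n}"
  by (auto simp: pairs_def less_Suc_eq)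

lemma pairs_0 [simp]: "pairs 0 = {}"
  by (simp add: pairs_def)

lemma finite_pairs [simp]: "finite (pairs n)"
  by (induction n) (auto simp: pairs_Suc)

lemma blocks_eq: "blocks k = pairs k \<union> (\<lambda>a. (a, a)) ` {..<k}"
  by (auto simp: pairs_def blocks_def)

lemma finite_blocks [simp]: "finite (blocks k)"
  by (simp add: blocks_eq)

lemma card_pairs_le: "real (card (pairs n)) \<le> (real n)\<^sup>2"
proof -
  have "card (pairs n) \<le> card ({..<n} \<times> {..<n})"
    by (intro card_mono) (auto simp: pairs_def)
  also have "\<dots> = n ^ 2"
    by (simp add: card_cartesian_product power2_eq_square)
  finally show ?thesis
    by (metis of_nat_mono of_nat_power)
qed

lemma block_in_blocks: "(\<And>i. i < n \<Longrightarrow> e i < k) \<Longrightarrow> block e ` pairs n \<subseteq> blocks k"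
  by (auto simp: block_def pairs_def blocks_def)

lemma block_commute: "block e (j, i) = block e (i, j)"
  by (simp add: block_def min.commute max.commute)

lemma sum_square_pairs:
  fixes g :: "nat \<Rightarrow> nat \<Rightarrow> real"
  shows "(\<Sum>i<n. \<Sum>j<n. g i j) = (\<Sum>(i, j)\<in>pairs n. g i j + g j i) + (\<Sum>i<n. g i i)"
proof (induction n)
  case (Suc n)
  have "(\<Sum>(i, j)\<in>pairs (Suc n). g i j + g j i)
      = (\<Sum>(i, j)\<in>pairs n. g i j + g j i) + (\<Sum>(i, j)\<in>(\<lambda>i. (i, n)) ` {..<n}. g i j + g j i)"
    unfolding pairs_Suc by (intro sum.union_disjoint finite_pairs) (auto simp: pairs_def)
  also have "(\<Sum>(i, j)\<in>(\<lambda>i. (i, n)) ` {..<n}. g i j + g j i) = (\<Sum>i<n. g i n + g n i)"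
    by (subst sum.reindex) (auto simp: inj_on_def)
  finally show ?case
    using Suc by (simp add: sum.distrib)
qed simp

lemma sum_square_blocks:
  fixes g :: "nat \<Rightarrow> nat \<Rightarrow> real"
  assumes "\<And>a b. g a b = g b a"
  shows "(\<Sum>a<k. \<Sum>b<k. g a b) = (\<Sum>(a, b)\<in>blocks k. (if a = b then 1 else 2) * g a b)"
proof -
  have "(\<Sum>(a, b)\<in>blocks k. (if a = b then 1 else 2) * g a b)
      = (\<Sum>(a, b)\<in>pairs k. (if a = b then 1 else 2) * g a b)
        + (\<Sum>(a, b)\<in>(\<lambda>a. (a, a)) ` {..<k}. (if a = b then 1 else 2) * g a b)"
    unfolding blocks_eq by (intro sum.union_disjoint finite_pairs) (auto simp: pairs_def)
  also have "(\<Sum>(a, b)\<in>(\<lambda>a. (a, a)) ` {..<k}. (if a = b then 1 else 2) * g a b) = (\<Sum>a<k. g a a)"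
    by (subst sum.reindex) (auto simp: inj_on_def)
  also have "(\<Sum>(a, b)\<in>pairs k. (if a = b then 1 else 2) * g a b) = (\<Sum>(a, b)\<in>pairs k. g a b + g b a)"
  proof (intro sum.cong refl)
    fix x assume "x \<in> pairs k"
    then show "(case x of (a, b) \<Rightarrow> (if a = b then 1 else 2) * g a b) = (case x of (a, b) \<Rightarrow> g a b + g b a)"
      using assms[of "snd x" "fst x"] by (auto simp: pairs_def)
  qed
  finally show ?thesis
    by (simp add: sum_square_pairs)
qed

text \<open>An unordered pair with both ends in class \<open>a\<close> appears twice in the double
  sum, one between distinct classes only once. This is the reason for the halving in
  \<open>otil\<close> and \<open>ntil\<close>.\<close>

lemma sum_square_cell:
  fixes f :: "nat \<Rightarrow> nat \<Rightarrow> real"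
  assumes f: "\<And>i j. f i j = f j i" and ab: "a \<le> b"
  shows "(\<Sum>i<n. \<Sum>j<n. if e i = a \<and> e j = b \<and> i \<noteq> j then f i j else 0)
    = (if a = b then 2 else 1) * cell_sum (pairs n) (block e) (\<lambda>(i, j). f i j) (a, b)"
proof -
  have "(\<Sum>i<n. \<Sum>j<n. if e i = a \<and> e j = b \<and> i \<noteq> j then f i j else 0)
      = (\<Sum>(i, j)\<in>pairs n. (if e i = a \<and> e j = b \<and> i \<noteq> j then f i j else 0)
          + (if e j = a \<and> e i = b \<and> j \<noteq> i then f j i else 0))"
    by (subst sum_square_pairs) simp
  also have "\<dots> = (\<Sum>p\<in>pairs n. if block e p = (a, b) then (if a = b then 2 else 1) * (case p of (i, j) \<Rightarrow> f i j) else 0)"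
  proof (intro sum.cong refl)
    fix p assume "p \<in> pairs n"
    then obtain i j where p: "p = (i, j)" "i < j"
      by (auto simp: pairs_def)
    have block: "block e (i, j) = (a, b) \<longleftrightarrow> e i = a \<and> e j = b \<or> e j = a \<and> e i = b"
      using ab by (auto simp: block_def min_def max_def)
    have "(if x = a \<and> y = b \<and> i \<noteq> j then r else 0) + (if y = a \<and> x = b \<and> j \<noteq> i then r else 0)
        = (if x = a \<and> y = b \<or> y = a \<and> x = b then (if a = b then 2 else 1) * r else 0)"
      for x y and r :: real
      using p(2) by (cases "a = b"; cases "x = a") simp_all
    then show "(case p of (i, j) \<Rightarrow> (if e i = a \<and> e j = b \<and> i \<noteq> j then f i j else 0)
          + (if e j = a \<and> e i = b \<and> j \<noteq> i then f j i else 0))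
        = (if block e p = (a, b) then (if a = b then 2 else 1) * (case p of (i, j) \<Rightarrow> f i j) else 0)"
      unfolding p(1) prod.case block f[of j i] .
  qed
  also have "\<dots> = (\<Sum>p\<in>{p \<in> pairs n. block e p = (a, b)}. (if a = b then 2 else 1) * (case p of (i, j) \<Rightarrow> f i j))"
    by (subst sum.inter_filter) auto
  finally show ?thesis
    unfolding cell_sum_def sum_distrib_left .
qed

section \<open>The two criteria as block profiles\<close>

lemma sym_adj_commute: "sym_adj B i j = sym_adj B j i"
  by (simp add: sym_adj_def)

lemma otil_eq_cell_sum:
  assumes "a \<le> b"
  shows "otil n (sym_adj B) e a b = cell_sum (pairs n) (block e) (\<lambda>p. of_bool (B p)) (a, b)"
proof -
  have "opair n (sym_adj B) e a b
      = (\<Sum>i<n. \<Sum>j<n. if e i = a \<and> e j = b \<and> i \<noteq> j then of_bool (sym_adj B i j) else 0)"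
    unfolding opair_def by (intro sum.cong refl) (auto simp: sym_adj_def)
  also have "\<dots> = (if a = b then 2 else 1)
      * cell_sum (pairs n) (block e) (\<lambda>(i, j). of_bool (sym_adj B i j)) (a, b)"
    using assms by (intro sum_square_cell) (auto simp: sym_adj_def)
  also have "cell_sum (pairs n) (block e) (\<lambda>(i, j). of_bool (sym_adj B i j)) (a, b)
      = cell_sum (pairs n) (block e) (\<lambda>p. of_bool (B p)) (a, b)"
    unfolding cell_sum_def by (intro sum.cong refl) (auto simp: pairs_def sym_adj_def)
  finally show ?thesis
    by (cases "a = b") (simp_all add: otil_def)
qed

lemma cnt_eq_sum: "cnt n e a = (\<Sum>i<n. if e i = a then 1 else 0)"
  by (simp add: cnt_def sum.If_cases Int_def)

lemma ntil_eq_cell_sum: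
  assumes "a \<le> b"
  shows "ntil n e a b = cell_sum (pairs n) (block e) (\<lambda>_. 1) (a, b)"
proof -
  have "(\<Sum>i<n. \<Sum>j<n. if e i = a \<and> e j = b then 1 else 0 :: real)
      = (\<Sum>i<n. \<Sum>j<n. (if e i = a then 1 else 0) * (if e j = b then 1 else 0))"
    by (intro sum.cong refl) auto
  also have "\<dots> = cnt n e a * cnt n e b"
    unfolding cnt_eq_sum sum_product ..
  finally have prod: "(\<Sum>i<n. \<Sum>j<n. if e i = a \<and> e j = b then 1 else 0) = cnt n e a * cnt n e b" .
  \<comment> \<open>Terms with i = j occur only in diagonal blocks; removing them gives the factor
    \<open>cnt n e a - 1\<close> there.\<close>
  have "(if a = b then cnt n e a else 0) = (\<Sum>i<n. if e i = a \<and> e i = b then 1 else 0)"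
  proof (cases "a = b")
    case False
    then have "(if e i = a \<and> e i = b then 1 else 0) = (0 :: real)" for i
      by auto
    with False show ?thesis
      by (simp only: sum.neutral_const if_False)
  qed (simp add: cnt_eq_sum)
  with prod have "cnt n e a * cnt n e b - (if a = b then cnt n e a else 0)
      = (\<Sum>i<n. \<Sum>j<n. if e i = a \<and> e j = b then 1 else 0) - (\<Sum>i<n. if e i = a \<and> e i = b then 1 else 0)"
    by simp
  also have "\<dots> = (\<Sum>i<n. \<Sum>j<n. if e i = a \<and> e j = b \<and> i \<noteq> j then 1 else 0)"
    unfolding sum_square_pairs by (auto intro!: sum.cong simp: pairs_def)
  also have "\<dots> = (if a = b then 2 else 1) * cell_sum (pairs n) (block e) (\<lambda>(i, j). 1) (a, b)"
    using assms by (intro sum_square_cell) auto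
  finally show ?thesis
    by (simp add: ntil_def npair_def case_prod_beta' right_diff_distrib split: if_splits)
qed

text \<open>The argument of \<open>tau\<close> is unchanged when both counts are halved. Hence the
  prefactor 1/2 cancels the double occurrence of off-diagonal blocks and passes to unordered pairs
  in diagonal ones.\<close>

lemma Q_ML_eq_profile:
  assumes "n > 0"
  shows "(real n)\<^sup>2 * Q_ML k n (sym_adj B) e = profile (pairs n) (blocks k) (\<lambda>p. of_bool (B p)) (block e)"
proof -
  define g where "g = (\<lambda>a b. npair n e a b * tau (opair n (sym_adj B) e a b / npair n e a b))"
  have "opair n (sym_adj B) e a b = opair n (sym_adj B) e b a" for a b
    unfolding opair_def by (subst sum.swap) (simp add: conj_commute conj_left_commute sym_adj_commute)
  then have g: "g a b = g b a" for a b
    by (simp add: g_def npair_def mult.commute)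
  have "(real n)\<^sup>2 * Q_ML k n (sym_adj B) e = (\<Sum>a<k. \<Sum>b<k. g a b) / 2"
    using assms by (simp add: Q_ML_def g_def)
  also have "\<dots> = (\<Sum>(a, b)\<in>blocks k. (if a = b then 1 else 2) * g a b / 2)"
    by (simp add: sum_square_blocks[OF g] sum_divide_distrib case_prod_unfold)
  also have "\<dots> = profile (pairs n) (blocks k) (\<lambda>p. of_bool (B p)) (block e)"
    unfolding profile_def
  proof (intro sum.cong refl)
    fix u assume "u \<in> blocks k"
    then obtain a b where u: "u = (a, b)" "a \<le> b"
      by (auto simp: blocks_def)
    show "(case u of (a, b) \<Rightarrow> (if a = b then 1 else 2) * g a b / 2)
      = cell_sum (pairs n) (block e) (\<lambda>_. 1) u * tau (cell_sum (pairs n) (block e) (\<lambda>p. of_bool (B p)) u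
          / cell_sum (pairs n) (block e) (\<lambda>_. 1) u)"
      using u(2) unfolding u(1) ntil_eq_cell_sum[OF u(2), symmetric] otil_eq_cell_sum[OF u(2), symmetric]
      by (auto simp: g_def ntil_def otil_def)
  qed
  finally show ?thesis .
qed

text \<open>Each block costs a logarithm of its size, which is at most \<open>n^2\<close>, and the
  number of blocks does not depend on \<open>n\<close>.\<close>

lemma Q_ICL_approx_profile:
  assumes "n > 0"
  shows "\<bar>(real n)\<^sup>2 * Q_ICL k n (sym_adj B) e - profile (pairs n) (blocks k) (\<lambda>p. of_bool (B p)) (block e)\<bar>
    \<le> real (card (blocks k)) * (2 + 3 * ln (2 * (real n)\<^sup>2 + 1))"
proof -
  define N where "N = cell_sum (pairs n) (block e) (\<lambda>_. 1)"
  define O' where "O' = cell_sum (pairs n) (block e) (\<lambda>p. of_bool (B p))"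
  define t where "t = (\<lambda>u. ln (Beta (O' u + 1 / 2) (N u - O' u + 1 / 2) / Beta (1 / 2) (1 / 2)))"
  have t: "\<bar>t u - N u * tau (O' u / N u)\<bar> \<le> 2 + 3 * ln (2 * (real n)\<^sup>2 + 1)" for u
  proof -
    define M where "M = card {p \<in> pairs n. block e p = u}"
    define m where "m = card {p \<in> pairs n. block e p = u \<and> B p}"
    have M: "N u = real M"
      by (simp add: N_def cell_sum_def M_def)
    have m: "O' u = real m"
      by (simp add: O'_def cell_sum_def m_def Int_def conj_assoc)
    have "m \<le> M"
      unfolding m_def M_def by (intro card_mono) auto
    have "M \<le> card (pairs n)"
      unfolding M_def by (intro card_mono) auto
    then have "real M \<le> (real n)\<^sup>2"
      using card_pairs_le[of n] by linarith
    show ?thesis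
    proof (cases "M = 0")
      \<comment> \<open>For an empty block both terms vanish: the beta ratio is 1, given that
        \<open>Beta (1 / 2) (1 / 2)\<close> is nonzero.\<close>
      case True
      have "Gamma (1 / 2 :: real) \<noteq> 0"
        using Gamma_real_pos[of "1/2 :: real"] by linarith
      then have "Beta (1 / 2) (1 / 2 :: real) \<noteq> 0"
        by (simp add: Beta_def)
      with True \<open>m \<le> M\<close> show ?thesis
        by (simp add: t_def M m)
    next
      case False
      then have "\<bar>t u - N u * tau (O' u / N u)\<bar> \<le> 2 + 3 * ln (2 * real M + 1)"
        unfolding t_def M m using \<open>m \<le> M\<close> by (intro ln_Beta_approx) auto
      also have "ln (2 * real M + 1) \<le> ln (2 * (real n)\<^sup>2 + 1)"
        using \<open>real M \<le> (real n)\<^sup>2\<close> by (intro iffD2[OF ln_le_cancel_iff]) linarith+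
      finally show ?thesis
        by simp
    qed
  qed
  have "(real n)\<^sup>2 * Q_ICL k n (sym_adj B) e = (\<Sum>u\<in>blocks k. t u)"
    using assms
    by (auto simp: Q_ICL_def blocks_def t_def N_def O'_def otil_eq_cell_sum ntil_eq_cell_sum intro!: sum.cong)
  then have "\<bar>(real n)\<^sup>2 * Q_ICL k n (sym_adj B) e - profile (pairs n) (blocks k) (\<lambda>p. of_bool (B p)) (block e)\<bar>
      = \<bar>\<Sum>u\<in>blocks k. t u - N u * tau (O' u / N u)\<bar>"
    by (simp add: profile_def N_def O'_def sum_subtractf)
  also have "\<dots> \<le> (\<Sum>u\<in>blocks k. 2 + 3 * ln (2 * (real n)\<^sup>2 + 1))"
    using t by (intro order.trans[OF sum_abs] sum_mono) auto
  finally show ?thesis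
    by simp
qed

section \<open>From a small within-block variance to a matching of the classes\<close>

lemma rectangle_sum_le:
  fixes h :: "nat \<Rightarrow> nat \<Rightarrow> real"
  assumes h: "\<And>i j. h i j = h j i" "\<And>i j. 0 \<le> h i j"
    and I: "I \<subseteq> {..<n}" "J \<subseteq> {..<n}" and h0: "\<And>i j. i \<in> I \<Longrightarrow> j \<in> J \<Longrightarrow> i \<noteq> j \<Longrightarrow> h i j = h0" "0 \<le> h0"
    and t: "2 \<le> t" "t \<le> real (card I)" "t \<le> real (card J)"
  shows "h0 * (t\<^sup>2 / 4) \<le> (\<Sum>(i, j)\<in>pairs n. h i j)"
proof -
  have fin: "finite I" "finite J"
    using I finite_subset by auto
  have inner: "t / 2 * h0 \<le> (\<Sum>j<n. if i = j then 0 else h i j)" if i: "i \<in> I" for i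
  proof -
    \<comment> \<open>\<open>I\<close> and \<open>J\<close> may overlap, so the diagonal has to be
      removed; \<open>2 \<le> t\<close> turns \<open>t - 1\<close> into at least
      \<open>t / 2\<close>.\<close>
    have "card J - 1 \<le> card (J - {i})"
      using fin by (simp add: card_Diff_singleton_if)
    then have "real (card J) - 1 \<le> real (card (J - {i}))"
      by linarith
    then have "t / 2 * h0 \<le> real (card (J - {i})) * h0"
      using t h0 by (intro mult_right_mono) auto
    also have "\<dots> = (\<Sum>j\<in>J - {i}. if i = j then 0 else h i j)"
      using h0 i by (simp add: sum.cong[of "J - {i}" "J - {i}" "\<lambda>j. if i = j then 0 else h i j" "\<lambda>_. h0"])
    also have "\<dots> \<le> (\<Sum>j<n. if i = j then 0 else h i j)"
      using I h by (intro sum_mono2) auto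
    finally show ?thesis .
  qed
  have "t * (t / 2 * h0) \<le> real (card I) * (t / 2 * h0)"
    using t h0 by (intro mult_right_mono) auto
  also have "\<dots> = (\<Sum>i\<in>I. t / 2 * h0)"
    by simp
  also have "\<dots> \<le> (\<Sum>i\<in>I. \<Sum>j<n. if i = j then 0 else h i j)"
    by (intro sum_mono inner)
  also have "\<dots> \<le> (\<Sum>i<n. \<Sum>j<n. if i = j then 0 else h i j)"
    using I h by (intro sum_mono2) (auto intro!: sum_nonneg)
  \<comment> \<open>Passing to unordered pairs loses another factor 2, whence
    \<open>t^2 / 4\<close>.\<close>
  also have "\<dots> = (\<Sum>(i, j)\<in>pairs n. 2 * h i j)"
    unfolding sum_square_pairs using h(1) by (auto intro!: sum.cong simp: pairs_def)
  finally show ?thesis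
    by (simp add: case_prod_unfold power2_eq_square mult_ac flip: sum_distrib_left)
qed

text \<open>Two communities that share a large part of an estimated class would have to be connected to every
  large intersection of classes with the same density; hence the classes match up to a permutation.\<close>

lemma mismatch_le:
  fixes m :: "nat \<times> nat \<Rightarrow> real"
  assumes e: "\<And>i. i < n \<Longrightarrow> e i < k" and z: "\<And>i. z i < k"
    and S: "\<And>a b. a < k \<Longrightarrow> b < k \<Longrightarrow> S a b = S b a"
    and sep: "\<And>b b'. b < k \<Longrightarrow> b' < k \<Longrightarrow> b \<noteq> b' \<Longrightarrow> \<exists>c<k. \<kappa> \<le> \<bar>S b c - S b' c\<bar>" and \<kappa>: "0 < \<kappa>"
    and cnt: "\<And>b. b < k \<Longrightarrow> real k * t \<le> cnt n z b" and t: "2 \<le> t"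
    and close: "(\<Sum>p\<in>pairs n. (S (z (fst p)) (z (snd p)) - m (block e p))\<^sup>2) \<le> t\<^sup>2 * \<kappa>\<^sup>2 / 32"
  shows "real (mismatch k n e z) \<le> real k ^ 2 * t"
proof -
  \<comment> \<open>The cells of the confusion matrix; below, a cell with at least \<open>t\<close>
    nodes counts as large.\<close>
  define K where "K = (\<lambda>a b. {i. i < n \<and> e i = a \<and> z i = b})"
  have K_fin: "finite (K a b)" "K a b \<subseteq> {..<n}" for a b
    by (auto simp: K_def)
  have sym: "(S (z i) (z j) - m (block e (i, j)))\<^sup>2 = (S (z j) (z i) - m (block e (j, i)))\<^sup>2" for i j
    unfolding block_commute[of e j i] using S[OF z z, of i j] by simp
  \<comment> \<open>Two large cells span at least \<open>t^2 / 4\<close> pairs with the same squared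
    deviation, while the whole sum is at most \<open>t^2 * \<kappa>^2 / 32\<close>; dividing gives
    \<open>\<kappa>^2 / 8\<close>.\<close>
  have dens: "(S b c - m (min a d, max a d))\<^sup>2 \<le> \<kappa>\<^sup>2 / 8"
    if "t \<le> real (card (K a b))" "t \<le> real (card (K d c))" for a b c d
  proof -
    have "(S b c - m (min a d, max a d))\<^sup>2 * (t\<^sup>2 / 4)
      \<le> (\<Sum>(i, j)\<in>pairs n. (S (z i) (z j) - m (block e (i, j)))\<^sup>2)"
      using that t K_fin sym
      by (intro rectangle_sum_le[of _ "K a b" _ "K d c"]) (auto simp: K_def block_def)
    also have "\<dots> \<le> t\<^sup>2 * \<kappa>\<^sup>2 / 32"
      using close by (simp add: case_prod_unfold)
    finally show ?thesis
      using t by (simp add: field_simps)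
  qed
  \<comment> \<open>Pigeonhole: a true class of size at least \<open>k * t\<close> is split into
    \<open>k\<close> cells.\<close>
  have ex: "\<exists>a<k. t \<le> real (card (K a b))" if b: "b < k" for b
  proof (rule ccontr)
    assume "\<not> ?thesis"
    then have small: "\<And>a. a < k \<Longrightarrow> real (card (K a b)) < t"
      by auto
    have "{i. i < n \<and> z i = b} = (\<Union>a<k. K a b)"
      using e by (auto simp: K_def)
    then have "card {i. i < n \<and> z i = b} \<le> (\<Sum>a<k. card (K a b))"
      using card_UN_le[of "{..<k}" "\<lambda>a. K a b"] by simp
    then have "cnt n z b \<le> (\<Sum>a<k. real (card (K a b)))"
      unfolding cnt_def of_nat_sum[symmetric] by (rule of_nat_mono)
    also have "\<dots> < (\<Sum>a<k. t)"
      using small b by (intro sum_strict_mono) auto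
    finally show False
      using cnt[OF b] by simp
  qed
  \<comment> \<open>If \<open>b\<close> and \<open>b'\<close> were different, a class
    \<open>c\<close> would separate them by \<kappa>. With \<open>d\<close> an estimated class
    holding a large part of \<open>c\<close>, both \<open>S b c\<close> and \<open>S b' c\<close>
    are near the same value of \<open>m\<close>, which bounds their squared distance by
    \<open>\<kappa>^2 / 2\<close>.\<close>
  have unique: "b = b'" if b: "b < k" "b' < k" and K: "t \<le> real (card (K a b))" "t \<le> real (card (K a b'))" for a b b'
  proof (rule ccontr)
    assume "b \<noteq> b'"
    then obtain c where c: "c < k" "\<kappa> \<le> \<bar>S b c - S b' c\<bar>"
      using sep b by blast
    obtain d where d: "t \<le> real (card (K d c))"
      using ex[OF c(1)] by blast
    define x y where "x = S b c - m (min a d, max a d)" and "y = S b' c - m (min a d, max a d)"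
    have "\<kappa>\<^sup>2 \<le> (x - y)\<^sup>2"
      using power_mono[OF c(2), of 2] \<kappa> by (simp add: x_def y_def)
    also have "\<dots> \<le> 2 * x\<^sup>2 + 2 * y\<^sup>2"
      using zero_le_power2[of "x + y"] by (simp add: power2_eq_square algebra_simps)
    also have "\<dots> \<le> \<kappa>\<^sup>2 / 2"
      using dens[OF K(1) d] dens[OF K(2) d] by (simp add: x_def y_def)
    finally show False
      using \<kappa> by simp
  qed
  have "\<forall>b\<in>{..<k}. \<exists>a. a < k \<and> t \<le> real (card (K a b))"
    using ex by simp
  from bchoice[OF this] obtain \<sigma>0
    where \<sigma>0: "\<And>b. b < k \<Longrightarrow> \<sigma>0 b < k \<and> t \<le> real (card (K (\<sigma>0 b) b))"
    by auto
  define \<sigma> where "\<sigma> = (\<lambda>b. if b < k then \<sigma>0 b else b)"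
  have \<sigma>_big: "t \<le> real (card (K (\<sigma> b) b))" if "b < k" for b
    using \<sigma>0[OF that] that by (simp add: \<sigma>_def)
  have inj: "inj_on \<sigma> {..<k}"
  proof (rule inj_onI)
    fix b b' assume b: "b \<in> {..<k}" "b' \<in> {..<k}" "\<sigma> b = \<sigma> b'"
    then show "b = b'"
      using \<sigma>_big[of b] \<sigma>_big[of b'] by (intro unique[of b b' "\<sigma> b"]) auto
  qed
  have "\<sigma> ` {..<k} \<subseteq> {..<k}"
    using \<sigma>0 by (auto simp: \<sigma>_def)
  then have "bij_betw \<sigma> {..<k} {..<k}"
    using inj by (simp add: bij_betw_def endo_inj_surj)
  then have perm: "\<sigma> permutes {..<k}"
    by (intro bij_imp_permutes) (auto simp: \<sigma>_def)
  \<comment> \<open>Every estimated class already has a true class with a large cell in it, as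
    \<open>\<sigma>\<close> is onto; uniqueness keeps all other cells at size at most
    \<open>t\<close>.\<close>
  have small: "real (card (K a b)) \<le> t" if ab: "a < k" "b < k" "a \<noteq> \<sigma> b" for a b
  proof (rule ccontr)
    assume "\<not> ?thesis"
    then have big: "t \<le> real (card (K a b))" by simp
    have "a \<in> \<sigma> ` {..<k}"
      using bij_betw_imp_surj_on[OF \<open>bij_betw \<sigma> {..<k} {..<k}\<close>] ab(1) by simp
    then obtain b' where b': "b' < k" "\<sigma> b' = a"
      by auto
    then have "t \<le> real (card (K a b'))"
      using \<sigma>_big[of b'] by simp
    then have "b = b'"
      by (rule unique[OF ab(2) b'(1) big])
    with b' ab show False
      by simp
  qed
  have "mismatch k n e z \<le> card {i. i < n \<and> e i \<noteq> \<sigma> (z i)}"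
    unfolding mismatch_def
  proof (rule Min_le)
    show "finite {card {i. i < n \<and> e i \<noteq> \<sigma> (z i)} |\<sigma>. \<sigma> permutes {..<k}}"
      by (simp add: setcompr_eq_image finite_permutations)
  qed (use perm in auto)
  also have "{i. i < n \<and> e i \<noteq> \<sigma> (z i)} \<subseteq> (\<Union>(a, b)\<in>{(a, b). a < k \<and> b < k \<and> a \<noteq> \<sigma> b}. K a b)"
    using e z by (auto simp: K_def)
  then have "card {i. i < n \<and> e i \<noteq> \<sigma> (z i)}
      \<le> card (\<Union>(a, b)\<in>{(a, b) \<in> {..<k} \<times> {..<k}. a \<noteq> \<sigma> b}. K a b)"
    using K_fin by (intro card_mono finite_UN_I) (auto intro: finite_subset[of _ "{..<k} \<times> {..<k}"])
  also have "\<dots> \<le> (\<Sum>(a, b)\<in>{(a, b) \<in> {..<k} \<times> {..<k}. a \<noteq> \<sigma> b}. card (K a b))"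
    by (rule order.trans[OF card_UN_le]) (auto simp: case_prod_unfold intro: finite_subset[of _ "{..<k} \<times> {..<k}"])
  finally have "real (mismatch k n e z) \<le> (\<Sum>(a, b)\<in>{(a, b) \<in> {..<k} \<times> {..<k}. a \<noteq> \<sigma> b}. real (card (K a b)))"
    by (simp add: case_prod_unfold flip: of_nat_sum)
  also have "\<dots> \<le> (\<Sum>(a, b)\<in>{(a, b) \<in> {..<k} \<times> {..<k}. a \<noteq> \<sigma> b}. t)"
    using small by (intro sum_mono) auto
  also have "\<dots> \<le> (\<Sum>(a, b)\<in>{..<k} \<times> {..<k}. t)"
    using t by (intro sum_mono2) auto
  also have "\<dots> = real k ^ 2 * t"
    by (simp add: power2_eq_square)
  finally show ?thesis .
qed

text \<open>Here \<open>c'\<close> is the true partition: \<open>w\<close> is constant on its cells,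
  so its Jensen gap is 0 and the loss of \<open>c\<close> is its whole gap. The factor
  \<open>8 * s1\<close> is \<open>4 * s1\<close> from strong convexity times 2 for expanding both
  profiles; the slack \<open>2 * r\<close> allows a criterion within \<open>r\<close> of the profile
  at each partition.\<close>

lemma profile_maximizer_variance:
  fixes w b :: "'p \<Rightarrow> real" and c c' :: "'p \<Rightarrow> 'u"
  assumes P: "finite P" "finite U" "c ` P \<subseteq> U" "c' ` P \<subseteq> U"
    and w: "\<And>p. p \<in> P \<Longrightarrow> w p \<in> {s0..s1}" and s0: "0 < s0" "0 < s1"
    and g: "\<And>p. p \<in> P \<Longrightarrow> w p = g (c' p)"
    and \<rho>: "0 < \<rho>" "2 * s1 * \<rho> < 1" and \<eta>: "\<eta> \<le> s0 / 2"
    and conc: "\<And>u. u \<in> U \<Longrightarrow> \<bar>cell_sum P c b u - \<rho> * cell_sum P c w u\<bar> \<le> \<eta> * \<rho> * cell_sum P c (\<lambda>_. 1) u"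
    and conc': "\<And>u. u \<in> U \<Longrightarrow> \<bar>cell_sum P c' b u - \<rho> * cell_sum P c' w u\<bar> \<le> \<eta> * \<rho> * cell_sum P c' (\<lambda>_. 1) u"
    and max: "profile P U b c' \<le> profile P U b c + 2 * r"
  shows "(\<Sum>p\<in>P. (w p - cell_sum P c w (c p) / cell_sum P c (\<lambda>_. 1) (c p))\<^sup>2)
    \<le> 8 * s1 * (real (card P) * ((1 + \<bar>ln (s0 / 2)\<bar> + \<bar>ln (2 * s1)\<bar>) * \<eta> + 4 * s1\<^sup>2 * \<rho>) + r / \<rho>)"
proof -
  define err where "err = (1 + \<bar>ln (s0 / 2)\<bar> + \<bar>ln (2 * s1)\<bar>) * \<eta> + 4 * s1\<^sup>2 * \<rho>"
  define V where "V = (\<Sum>p\<in>P. (w p - cell_sum P c w (c p) / cell_sum P c (\<lambda>_. 1) (c p))\<^sup>2)"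
  define H where "H = (\<lambda>c. \<Sum>u\<in>U. cell_sum P c (\<lambda>_. 1) u * xlogx (cell_sum P c w u / cell_sum P c (\<lambda>_. 1) u))"
  have "cell_sum P c' (\<lambda>_. 1) u * xlogx (cell_sum P c' w u / cell_sum P c' (\<lambda>_. 1) u)
      = cell_sum P c' (\<lambda>p. xlogx (w p)) u" for u
  proof -
    have const: "cell_sum P c' (\<lambda>p. f (w p)) u = cell_sum P c' (\<lambda>_. 1) u * f (g u)" for f
      using g by (simp add: cell_sum_def)
    show ?thesis
      using const[of xlogx] const[of "\<lambda>x. x"] by (cases "cell_sum P c' (\<lambda>_. 1) u = 0") auto
  qed
  then have H': "H c' = (\<Sum>p\<in>P. xlogx (w p))"
    using P by (simp add: H_def sum_cell_sum)
  define L where "L = (ln \<rho> - 1) * (\<Sum>p\<in>P. b p)"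
  have "\<bar>profile P U b c - (L + \<rho> * H c)\<bar> \<le> \<rho> * real (card P) * err"
    unfolding L_def H_def err_def using P w s0 \<rho> \<eta> conc by (intro profile_expansion) auto
  moreover have "\<bar>profile P U b c' - (L + \<rho> * H c')\<bar> \<le> \<rho> * real (card P) * err"
    unfolding L_def H_def err_def using P w s0 \<rho> \<eta> conc' by (intro profile_expansion) auto
  ultimately have "\<rho> * H c' - \<rho> * H c \<le> 2 * (\<rho> * real (card P) * err) + 2 * r"
    using max by linarith
  also have "\<dots> = \<rho> * (2 * (real (card P) * err + r / \<rho>))"
    using \<rho> by (simp add: field_simps)
  finally have gap: "H c' - H c \<le> 2 * (real (card P) * err + r / \<rho>)"
    using \<rho> by (simp flip: right_diff_distrib)
  have "V / (4 * s1) \<le> H c' - H c"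
    unfolding V_def H' using xlogx_jensen_gap[of P U c w s0 s1] P w s0 by (simp add: H_def)
  with gap have "V / (4 * s1) \<le> 2 * (real (card P) * err + r / \<rho>)"
    by linarith
  then have "V \<le> 8 * s1 * (real (card P) * err + r / \<rho>)"
    using s0 by (simp add: field_simps)
  then show ?thesis
    by (simp add: V_def err_def)
qed

subsection \<open>Uniform concentration\<close>

text \<open>Separates the randomness of the labels from that of the edges; \<open>Bad\<close> will
  be the set of label vectors with too small a class.\<close>

lemma measure_bind_pmf_le:
  assumes "\<And>x. x \<in> set_pmf M \<Longrightarrow> x \<notin> Bad \<Longrightarrow> measure_pmf.prob (f x) X \<le> \<delta>" "0 \<le> \<delta>"
  shows "measure_pmf.prob (bind_pmf M f) X \<le> measure_pmf.prob M Bad + \<delta>"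
proof -
  have "emeasure (measure_pmf (bind_pmf M f)) X = (\<integral>\<^sup>+x. emeasure (measure_pmf (f x)) X \<partial>measure_pmf M)"
    by simp
  also have "\<dots> \<le> (\<integral>\<^sup>+x. indicator Bad x + ennreal \<delta> \<partial>measure_pmf M)"
  proof (intro nn_integral_mono_AE AE_pmfI)
    fix x assume x: "x \<in> set_pmf M"
    show "emeasure (measure_pmf (f x)) X \<le> indicator Bad x + ennreal \<delta>"
    proof (cases "x \<in> Bad")
      case True
      then show ?thesis
        by (auto intro: order.trans[OF measure_pmf.emeasure_le_1] add_increasing2)
    next
      case False
      then show ?thesis
        using assms(1)[OF x] by (simp add: measure_pmf.emeasure_eq_measure ennreal_leI)
    qed
  qed
  also have "\<dots> = ennreal (measure_pmf.prob M Bad + \<delta>)"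
    using assms(2) by (simp add: nn_integral_add measure_pmf.emeasure_eq_measure ennreal_plus)
  finally show ?thesis
    using assms(2) unfolding measure_pmf.emeasure_eq_measure by (subst (asm) ennreal_le_iff) auto
qed

text \<open>Diagonal blocks decide the constant: they count unordered pairs, and
  \<open>2 \<le> t\<close> gives \<open>t - 1 \<ge> t / 2\<close>.\<close>

lemma ntil_lower_bound:
  assumes "t \<le> cnt n e a" "t \<le> cnt n e b" "2 \<le> t"
  shows "t\<^sup>2 / 4 \<le> ntil n e a b"
proof (cases "a = b")
  case True
  have "t\<^sup>2 / 4 = t / 2 * t / 2"
    by (simp add: power2_eq_square)
  also have "\<dots> \<le> (cnt n e a - 1) * cnt n e a / 2"
    using assms by (intro divide_right_mono mult_mono) auto
  finally show ?thesis
    using True by (simp add: ntil_def npair_def mult.commute)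
next
  case False
  have "t\<^sup>2 / 4 \<le> t * t"
    by (simp add: power2_eq_square)
  also have "\<dots> \<le> cnt n e a * cnt n e b"
    using assms by (intro mult_mono) auto
  finally show ?thesis
    using False by (simp add: ntil_def npair_def)
qed

lemma Fset_subset: "Fset k n \<alpha> \<subseteq> PiE_dflt {..<n} 0 (\<lambda>_. {..<k})"
  by (auto simp: Fset_def PiE_dflt_def)

lemma finite_Fset: "finite (Fset k n \<alpha>)"
  by (rule finite_subset[OF Fset_subset]) auto

lemma card_Fset_le: "card (Fset k n \<alpha>) \<le> k ^ n"
proof -
  have "card (Fset k n \<alpha>) \<le> card (PiE_dflt {..<n} 0 (\<lambda>_. {..<k}))"
    by (intro card_mono Fset_subset) auto
  also have "\<dots> = k ^ n"
    by (subst card_PiE_dflt) auto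
  finally show ?thesis .
qed

definition edge_pmf :: "nat \<Rightarrow> (nat \<times> nat \<Rightarrow> real) \<Rightarrow> (nat \<times> nat \<Rightarrow> bool) pmf" where
  "edge_pmf n q = Pi_pmf (pairs n) False (\<lambda>p. bernoulli_pmf (q p))"

definition blockwise_close :: "nat \<Rightarrow> nat \<Rightarrow> real \<Rightarrow> (nat \<times> nat \<Rightarrow> real) \<Rightarrow> real \<Rightarrow> (nat \<times> nat \<Rightarrow> bool) \<Rightarrow> (nat \<Rightarrow> nat) \<Rightarrow> bool" where
  "blockwise_close k n \<rho> w \<eta> B e \<longleftrightarrow> (\<forall>u\<in>blocks k.
     \<bar>cell_sum (pairs n) (block e) (\<lambda>p. of_bool (B p)) u - \<rho> * cell_sum (pairs n) (block e) w u\<bar>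
       \<le> \<eta> * \<rho> * cell_sum (pairs n) (block e) (\<lambda>_. 1) u)"

text \<open>The deviations are relative to \<open>\<rho>\<close> times the block size; this multiplicative form is what makes
  a union bound over all \<open>k ^ n\<close> labellings affordable as soon as \<open>n * \<rho>\<close> is large.\<close>

lemma prob_not_blockwise_close:
  assumes w: "\<And>p. p \<in> pairs n \<Longrightarrow> 0 \<le> w p \<and> w p \<le> s1" and \<rho>: "0 < \<rho>" "s1 * \<rho> \<le> 1"
    and \<eta>: "0 < \<eta>" "\<eta> \<le> s1" and \<alpha>: "2 \<le> \<alpha> * real n"
  shows "measure_pmf.prob (edge_pmf n (\<lambda>p. \<rho> * w p)) {B. \<exists>e\<in>Fset k n \<alpha>. \<not> blockwise_close k n \<rho> w \<eta> B e}
    \<le> real k ^ n * (real (card (blocks k)) * (2 * exp (- (\<eta>\<^sup>2 * \<rho> * (\<alpha> * real n)\<^sup>2 / (16 * s1)))))"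
proof -
  have s1: "0 < s1"
    using \<eta> by linarith
  define bad where "bad = (\<lambda>e u. {B.
     \<bar>cell_sum (pairs n) (block e) (\<lambda>p. of_bool (B p)) u - \<rho> * cell_sum (pairs n) (block e) w u\<bar>
       > \<eta> * \<rho> * cell_sum (pairs n) (block e) (\<lambda>_. 1) u})"
  define \<delta> where "\<delta> = 2 * exp (- (\<eta>\<^sup>2 * \<rho> * (\<alpha> * real n)\<^sup>2 / (16 * s1)))"
  have one: "measure_pmf.prob (edge_pmf n (\<lambda>p. \<rho> * w p)) (bad e u) \<le> \<delta>"
    if e: "e \<in> Fset k n \<alpha>" and u: "u \<in> blocks k" for e u
  proof -
    obtain a b where ab: "u = (a, b)" "a \<le> b" "b < k"
      using u by (auto simp: blocks_def)
    define C where "C = {p \<in> pairs n. block e p = u}"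
    define N where "N = cell_sum (pairs n) (block e) (\<lambda>_. 1) u"
    have "(\<alpha> * real n)\<^sup>2 / 4 \<le> ntil n e a b"
      using e ab \<alpha> by (intro ntil_lower_bound) (auto simp: Fset_def)
    then have N: "(\<alpha> * real n)\<^sup>2 / 4 \<le> N"
      using ntil_eq_cell_sum[OF ab(2), of n e] by (simp add: N_def ab)
    have "2\<^sup>2 \<le> (\<alpha> * real n)\<^sup>2"
      using \<alpha> by (intro power_mono) auto
    with N have N_pos: "0 < N"
      by simp
    have q: "measure_pmf.prob (bernoulli_pmf (\<rho> * w p)) {True} = \<rho> * w p" if "p \<in> C" for p
    proof -
      have "0 \<le> \<rho> * w p" "\<rho> * w p \<le> \<rho> * s1"
        using w[of p] that \<rho> by (auto simp: C_def)
      moreover from this(2) have "\<rho> * w p \<le> 1"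
        using \<rho>(2) unfolding mult.commute[of s1 \<rho>] by linarith
      ultimately show ?thesis
        by (simp add: measure_pmf_single)
    qed
    have sum_q: "(\<Sum>p\<in>C. measure_pmf.prob (bernoulli_pmf (\<rho> * w p)) {True}) = \<rho> * cell_sum (pairs n) (block e) w u"
      using q by (simp add: cell_sum_def C_def sum_distrib_left)
    have "cell_sum (pairs n) (block e) w u \<le> (\<Sum>p\<in>C. s1)"
      unfolding cell_sum_def C_def using w by (intro sum_mono) auto
    also have "\<dots> = s1 * N"
      by (simp add: N_def cell_sum_def C_def)
    finally have sum_q_le: "(\<Sum>p\<in>C. measure_pmf.prob (bernoulli_pmf (\<rho> * w p)) {True}) \<le> s1 * \<rho> * N"
      using \<rho> by (simp add: sum_q)
    \<comment> \<open>The mean is at most \<open>s1 * \<rho> * N\<close>, so the deviation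
      \<open>\<eta> * \<rho> * N\<close> is relative to that bound by the factor
      \<open>\<eta> / s1\<close>, which is at most 1. With \<open>N \<ge> (\<alpha> n)^2 / 4\<close>
      the exponent becomes the stated one.\<close>
    have "measure_pmf.prob (edge_pmf n (\<lambda>p. \<rho> * w p)) (bad e u)
        \<le> measure_pmf.prob (edge_pmf n (\<lambda>p. \<rho> * w p))
          {B. \<bar>(\<Sum>p\<in>C. of_bool (B p \<in> {True})) - (\<Sum>p\<in>C. measure_pmf.prob (bernoulli_pmf (\<rho> * w p)) {True})\<bar>
             \<ge> \<eta> / s1 * (s1 * \<rho> * N)}"
      unfolding sum_q bad_def using s1
      by (intro measure_pmf.finite_measure_mono) (auto simp: cell_sum_def C_def N_def mult_ac simp del: sum_of_bool_eq)
    also have "\<dots> \<le> 2 * exp (- ((\<eta> / s1)\<^sup>2 * (s1 * \<rho> * N) / 4))"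
      unfolding edge_pmf_def using sum_q_le s1 \<rho> N_pos \<eta>
      by (intro chernoff[where E = "\<lambda>_. {True}"]) (auto simp: C_def field_simps)
    also have "(\<eta> / s1)\<^sup>2 * (s1 * \<rho> * N) / 4 = \<eta>\<^sup>2 * \<rho> / (4 * s1) * N"
      using s1 by (simp add: field_simps power2_eq_square)
    also have "2 * exp (- (\<eta>\<^sup>2 * \<rho> / (4 * s1) * N)) \<le> 2 * exp (- (\<eta>\<^sup>2 * \<rho> / (4 * s1) * ((\<alpha> * real n)\<^sup>2 / 4)))"
      using mult_left_mono[OF N, of "\<eta>\<^sup>2 * \<rho> / (4 * s1)"] s1 \<rho> by simp
    also have "\<dots> = \<delta>"
      by (simp add: \<delta>_def)
    finally show ?thesis .
  qed
  have "{B. \<exists>e\<in>Fset k n \<alpha>. \<not> blockwise_close k n \<rho> w \<eta> B e} = (\<Union>e\<in>Fset k n \<alpha>. \<Union>u\<in>blocks k. bad e u)"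
    by (auto simp: blockwise_close_def bad_def not_le)
  also have "measure_pmf.prob (edge_pmf n (\<lambda>p. \<rho> * w p)) \<dots>
      \<le> (\<Sum>e\<in>Fset k n \<alpha>. measure_pmf.prob (edge_pmf n (\<lambda>p. \<rho> * w p)) (\<Union>u\<in>blocks k. bad e u))"
    by (intro measure_UNION_le finite_Fset) auto
  also have "\<dots> \<le> (\<Sum>e\<in>Fset k n \<alpha>. \<Sum>u\<in>blocks k. measure_pmf.prob (edge_pmf n (\<lambda>p. \<rho> * w p)) (bad e u))"
    by (intro sum_mono measure_UNION_le) auto
  also have "\<dots> \<le> (\<Sum>e\<in>Fset k n \<alpha>. \<Sum>u\<in>blocks k. \<delta>)"
    by (intro sum_mono one)
  also have "\<dots> = real (card (Fset k n \<alpha>)) * (real (card (blocks k)) * \<delta>)"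
    by simp
  also have "\<dots> \<le> real (k ^ n) * (real (card (blocks k)) * \<delta>)"
    by (intro mult_right_mono of_nat_mono card_Fset_le) (auto simp: \<delta>_def)
  finally show ?thesis
    by (simp add: \<delta>_def)
qed

text \<open>The expected size of class \<open>a\<close> exceeds \<open>\<beta> * n\<close> by at
  least \<open>\<eta> * n\<close>, so a small class is a deviation of linear size.\<close>

lemma prob_small_class:
  assumes \<beta>: "\<And>a. a < k \<Longrightarrow> \<beta> + \<eta> \<le> pmf p a" and \<eta>: "0 < \<eta>" "\<eta> \<le> 2" and n: "0 < n"
  shows "measure_pmf.prob (Pi_pmf {..<n} 0 (\<lambda>_. p)) {z. \<exists>a<k. cnt n z a < \<beta> * real n}
    \<le> real k * (2 * exp (- (\<eta>\<^sup>2 * real n / 4)))"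
proof -
  have one: "measure_pmf.prob (Pi_pmf {..<n} 0 (\<lambda>_. p)) {z. cnt n z a < \<beta> * real n} \<le> 2 * exp (- (\<eta>\<^sup>2 * real n / 4))"
    if a: "a < k" for a
  proof -
    have "measure_pmf.prob (Pi_pmf {..<n} 0 (\<lambda>_. p)) {z. cnt n z a < \<beta> * real n}
      \<le> measure_pmf.prob (Pi_pmf {..<n} 0 (\<lambda>_. p))
        {z. \<bar>(\<Sum>i<n. of_bool (z i \<in> {a})) - (\<Sum>i<n. measure_pmf.prob p {a})\<bar> \<ge> \<eta> * real n}"
    proof (intro measure_pmf.finite_measure_mono subsetI)
      fix z assume "z \<in> {z. cnt n z a < \<beta> * real n}"
      then have "cnt n z a < \<beta> * real n" by simp
      moreover have "(\<Sum>i<n. of_bool (z i \<in> {a})) = cnt n z a"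
        by (auto simp: cnt_eq_sum intro!: sum.cong simp del: sum_of_bool_eq)
      moreover have "(\<beta> + \<eta>) * real n \<le> real n * pmf p a"
        using mult_right_mono[OF \<beta>[OF a], of "real n"] by (simp add: mult.commute)
      then have "\<beta> * real n + \<eta> * real n \<le> real n * pmf p a"
        by (simp add: distrib_right)
      ultimately show "z \<in> {z. \<bar>(\<Sum>i<n. of_bool (z i \<in> {a})) - (\<Sum>i<n. measure_pmf.prob p {a})\<bar> \<ge> \<eta> * real n}"
        by (simp add: measure_pmf_single del: sum_of_bool_eq)
    qed auto
    also have "\<dots> \<le> 2 * exp (- (\<eta>\<^sup>2 * real n / 4))"
    proof (intro chernoff)
      have "(\<Sum>i<n. measure_pmf.prob p {a}) \<le> (\<Sum>i<n. 1)"
        by (intro sum_mono) auto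
      then show "(\<Sum>i<n. measure_pmf.prob p {a}) \<le> real n"
        by simp
    qed (use \<eta> n in auto)
    finally show ?thesis .
  qed
  have "{z. \<exists>a<k. cnt n z a < \<beta> * real n} = (\<Union>a<k. {z. cnt n z a < \<beta> * real n})"
    by auto
  also have "measure_pmf.prob (Pi_pmf {..<n} 0 (\<lambda>_. p)) \<dots>
      \<le> (\<Sum>a<k. measure_pmf.prob (Pi_pmf {..<n} 0 (\<lambda>_. p)) {z. cnt n z a < \<beta> * real n})"
    by (intro measure_UNION_le) auto
  also have "\<dots> \<le> (\<Sum>a<k. 2 * exp (- (\<eta>\<^sup>2 * real n / 4)))"
    using one by (intro sum_mono) auto
  finally show ?thesis
    by simp
qed

subsection \<open>Consistency\<close>

text \<open>The deterministic part of the argument: \<open>small\<close> asks the variance left by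
  near-maximality to stay within the budget of the matching lemma. Symmetry of \<open>S\<close>
  makes the edge density a function of the sorted true block.\<close>

lemma maximizer_mismatch_le:
  assumes k: "0 < k" and \<rho>: "0 < \<rho>" "2 * s1 * \<rho> < 1" and s: "0 < s0" "0 < s1" and \<eta>: "\<eta> \<le> s0 / 2"
    and S: "\<And>a b. a < k \<Longrightarrow> b < k \<Longrightarrow> S a b = S b a" "\<And>a b. a < k \<Longrightarrow> b < k \<Longrightarrow> S a b \<in> {s0..s1}"
    and sep: "\<And>b b'. b < k \<Longrightarrow> b' < k \<Longrightarrow> b \<noteq> b' \<Longrightarrow> \<exists>c<k. \<kappa> \<le> \<bar>S b c - S b' c\<bar>" and \<kappa>: "0 < \<kappa>"
    and F: "z \<in> Fset k n \<alpha>" "e \<in> Fset k n \<alpha>"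
    and close: "\<And>e. e \<in> Fset k n \<alpha> \<Longrightarrow> blockwise_close k n \<rho> (\<lambda>p. S (z (fst p)) (z (snd p))) \<eta> B e"
    and max: "profile (pairs n) (blocks k) (\<lambda>p. of_bool (B p)) (block z)
      \<le> profile (pairs n) (blocks k) (\<lambda>p. of_bool (B p)) (block e) + 2 * r"
    and cnt: "\<And>b. b < k \<Longrightarrow> real k * t \<le> cnt n z b" and t: "2 \<le> t"
    and small: "8 * s1 * ((real n)\<^sup>2 * ((1 + \<bar>ln (s0 / 2)\<bar> + \<bar>ln (2 * s1)\<bar>) * \<eta> + 4 * s1\<^sup>2 * \<rho>) + r / \<rho>)
      \<le> t\<^sup>2 * \<kappa>\<^sup>2 / 32"
    and \<eta>0: "0 \<le> \<eta>"
  shows "real (mismatch k n e z) \<le> real k ^ 2 * t"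
proof -
  define w where "w = (\<lambda>p. S (z (fst p)) (z (snd p)))"
  define m where "m = (\<lambda>u. cell_sum (pairs n) (block e) w u / cell_sum (pairs n) (block e) (\<lambda>_. 1) u)"
  define err where "err = (1 + \<bar>ln (s0 / 2)\<bar> + \<bar>ln (2 * s1)\<bar>) * \<eta> + 4 * s1\<^sup>2 * \<rho>"
  have z: "z i < k" for i
    using F(1) k by (cases "i < n") (auto simp: Fset_def)
  have e: "e i < k" if "i < n" for i
    using F(2) that by (auto simp: Fset_def)
  have "(\<Sum>p\<in>pairs n. (w p - m (block e p))\<^sup>2) \<le> 8 * s1 * (real (card (pairs n)) * err + r / \<rho>)"
    unfolding m_def err_def
  proof (rule profile_maximizer_variance[where g = "\<lambda>(a, b). S a b" and c' = "block z" and U = "blocks k"])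
    show "block e ` pairs n \<subseteq> blocks k" "block z ` pairs n \<subseteq> blocks k"
      using e z by (auto intro!: block_in_blocks)
    show "w p = (case block z p of (a, b) \<Rightarrow> S a b)" for p
      using S(1)[OF z z] by (auto simp: w_def block_def min_def max_def split: prod.splits)
    show "w p \<in> {s0..s1}" for p
      using S(2)[OF z z] by (simp add: w_def)
  qed (use close[OF F(1)] close[OF F(2)] max \<rho> \<eta> s in \<open>auto simp: blockwise_close_def w_def\<close>)
  also have "\<dots> \<le> 8 * s1 * ((real n)\<^sup>2 * err + r / \<rho>)"
    using card_pairs_le[of n] s \<rho> \<eta>0 by (intro mult_left_mono add_right_mono mult_right_mono) (auto simp: err_def)
  also have "\<dots> \<le> t\<^sup>2 * \<kappa>\<^sup>2 / 32"
    using small by (simp add: err_def)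
  finally show ?thesis
    using e z S(1) sep \<kappa> cnt t by (intro mismatch_le[where \<kappa> = \<kappa> and S = S and m = m]) (auto simp: w_def)
qed

text \<open>A large mismatch requires one of two failures, which give the two summands: some true
  class is too small, or some feasible labelling has a block with an atypical edge count.\<close>

lemma prob_mismatch_le:
  fixes k n :: nat and p :: "nat pmf" and S :: "nat \<Rightarrow> nat \<Rightarrow> real"
  assumes k: "0 < k" and p_supp: "set_pmf p = {..<k}"
    and \<rho>: "0 < \<rho> n" "2 * s1 * \<rho> n < 1" and s: "0 < s0" "s0 \<le> s1" and \<eta>: "0 < \<eta>" "\<eta> \<le> s0 / 2"
    and S: "\<And>a b. a < k \<Longrightarrow> b < k \<Longrightarrow> S a b = S b a" "\<And>a b. a < k \<Longrightarrow> b < k \<Longrightarrow> S a b \<in> {s0..s1}"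
    and sep: "\<And>b b'. b < k \<Longrightarrow> b' < k \<Longrightarrow> b \<noteq> b' \<Longrightarrow> \<exists>c<k. \<kappa> \<le> \<bar>S b c - S b' c\<bar>" and \<kappa>: "0 < \<kappa>"
    and est: "is_maximizer Q k \<alpha> est"
    and Q: "\<And>B e. \<bar>(real n)\<^sup>2 * Q k n (sym_adj B) e - profile (pairs n) (blocks k) (\<lambda>p. of_bool (B p)) (block e)\<bar> \<le> r"
    and \<alpha>: "2 \<le> \<alpha> n * real n" "\<alpha> n \<le> \<beta>"
    and \<beta>: "\<And>a. a < k \<Longrightarrow> \<beta> + \<eta>' \<le> pmf p a" and \<eta>': "0 < \<eta>'" "\<eta>' \<le> 2"
    and t: "real k * t \<le> \<beta> * real n" "2 \<le> t"
    and small: "8 * s1 * ((real n)\<^sup>2 * ((1 + \<bar>ln (s0 / 2)\<bar> + \<bar>ln (2 * s1)\<bar>) * \<eta> + 4 * s1\<^sup>2 * \<rho> n) + r / \<rho> n)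
      \<le> t\<^sup>2 * \<kappa>\<^sup>2 / 32"
  shows "measure_pmf.prob (sbm p S \<rho> n) {(z, A). real (mismatch k n (est n A) z) > real k ^ 2 * t}
    \<le> real k * (2 * exp (- (\<eta>'\<^sup>2 * real n / 4)))
      + real k ^ n * (real (card (blocks k)) * (2 * exp (- (\<eta>\<^sup>2 * \<rho> n * (\<alpha> n * real n)\<^sup>2 / (16 * s1)))))"
proof -
  define w where "w = (\<lambda>(z :: nat \<Rightarrow> nat) (p :: nat \<times> nat). S (z (fst p)) (z (snd p)))"
  define bad where "bad = {(z, A). real (mismatch k n (est n A) z) > real k ^ 2 * t}"
  define \<delta> where "\<delta> = real k ^ n * (real (card (blocks k)) * (2 * exp (- (\<eta>\<^sup>2 * \<rho> n * (\<alpha> n * real n)\<^sup>2 / (16 * s1)))))"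
  have n: "0 < n"
    using \<alpha>(1) by (cases "n = 0") auto
  have s1: "0 < s1" and \<eta>0: "0 \<le> \<eta>"
    using s \<eta> by simp_all
  have sbm_eq: "sbm p S \<rho> n = bind_pmf (Pi_pmf {..<n} 0 (\<lambda>_. p))
      (\<lambda>z. map_pmf (\<lambda>B. (z, sym_adj B)) (edge_pmf n (\<lambda>p. \<rho> n * w z p)))"
    by (simp add: sbm_def edge_pmf_def pairs_def w_def case_prod_unfold)
  have cond: "measure_pmf.prob (map_pmf (\<lambda>B. (z, sym_adj B)) (edge_pmf n (\<lambda>p. \<rho> n * w z p))) bad \<le> \<delta>"
    if z_supp: "z \<in> set_pmf (Pi_pmf {..<n} 0 (\<lambda>_. p))" and z_big: "z \<notin> {z. \<exists>a<k. cnt n z a < \<beta> * real n}" for z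
  proof -
    have z_dflt: "\<forall>i<n. z i < k" "\<forall>i. n \<le> i \<longrightarrow> z i = 0"
      using z_supp p_supp by (auto simp: set_Pi_pmf PiE_dflt_def)
    have z_lt: "z i < k" for i
      using z_dflt k by (cases "i < n") auto
    have cnt: "\<beta> * real n \<le> cnt n z a" if "a < k" for a
      using z_big that by force
    have "\<alpha> n * real n \<le> \<beta> * real n"
      using \<alpha> by (intro mult_right_mono) auto
    \<comment> \<open>The true labelling has to be a competitor in the maximization; its membership
      also makes the feasible set nonempty, as \<open>is_maximizer\<close> requires.\<close>
    then have zF: "z \<in> Fset k n (\<alpha> n)"
      using z_dflt cnt by (fastforce simp: Fset_def)
    have "measure_pmf.prob (map_pmf (\<lambda>B. (z, sym_adj B)) (edge_pmf n (\<lambda>p. \<rho> n * w z p))) bad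
        = measure_pmf.prob (edge_pmf n (\<lambda>p. \<rho> n * w z p)) {B. (z, sym_adj B) \<in> bad}"
      by (simp add: vimage_def)
    also have "\<dots> \<le> measure_pmf.prob (edge_pmf n (\<lambda>p. \<rho> n * w z p))
        {B. \<exists>e\<in>Fset k n (\<alpha> n). \<not> blockwise_close k n (\<rho> n) (w z) \<eta> B e}"
    proof (intro measure_pmf.finite_measure_mono subsetI CollectI, rule ccontr)
      fix B assume B: "B \<in> {B. (z, sym_adj B) \<in> bad}"
        and "\<not> (\<exists>e\<in>Fset k n (\<alpha> n). \<not> blockwise_close k n (\<rho> n) (w z) \<eta> B e)"
      then have close: "\<And>e. e \<in> Fset k n (\<alpha> n) \<Longrightarrow> blockwise_close k n (\<rho> n) (w z) \<eta> B e"
        by blast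
      define e where "e = est n (sym_adj B)"
      have eF: "e \<in> Fset k n (\<alpha> n)" and "Q k n (sym_adj B) z \<le> Q k n (sym_adj B) e"
        using est zF by (auto simp: is_maximizer_def e_def)
      then have "(real n)\<^sup>2 * Q k n (sym_adj B) z \<le> (real n)\<^sup>2 * Q k n (sym_adj B) e"
        by (intro mult_left_mono) auto
      then have "profile (pairs n) (blocks k) (\<lambda>p. of_bool (B p)) (block z)
          \<le> profile (pairs n) (blocks k) (\<lambda>p. of_bool (B p)) (block e) + 2 * r"
        using Q[of B z] Q[of B e] by linarith
      note max = this
      have cnt': "real k * t \<le> cnt n z b" if "b < k" for b
        using cnt[OF that] t by linarith
      have "real (mismatch k n e z) \<le> real k ^ 2 * t"
        by (rule maximizer_mismatch_le[of k "\<rho> n" s1 s0 \<eta> S \<kappa> z n "\<alpha> n" e B r t])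
          (fact k \<rho> s(1) s1 \<eta>(2) \<eta>0 S sep \<kappa> zF eF close[unfolded w_def] max cnt' t(2) small)+
      with B show False
        by (simp add: bad_def e_def)
    qed auto
    also have "\<dots> \<le> \<delta>"
      unfolding \<delta>_def
    proof (rule prob_not_blockwise_close)
      show "0 \<le> w z p \<and> w z p \<le> s1" for p
        using S(2)[OF z_lt z_lt, of "fst p" "snd p"] s by (simp add: w_def)
      have "0 < s1 * \<rho> n"
        using \<rho> s by simp
      then show "s1 * \<rho> n \<le> 1"
        using \<rho> by linarith
    qed (use \<rho> \<eta> s \<alpha> in auto)
    finally show ?thesis .
  qed
  have "measure_pmf.prob (sbm p S \<rho> n) bad
      \<le> measure_pmf.prob (Pi_pmf {..<n} 0 (\<lambda>_. p)) {z. \<exists>a<k. cnt n z a < \<beta> * real n} + \<delta>"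
    unfolding sbm_eq using cond by (intro measure_bind_pmf_le) (auto simp: \<delta>_def)
  also have "\<dots> \<le> real k * (2 * exp (- (\<eta>'\<^sup>2 * real n / 4))) + \<delta>"
    using prob_small_class[OF \<beta> \<eta>' n] by simp
  finally show ?thesis
    by (simp add: bad_def \<delta>_def)
qed

text \<open>Once \<open>c * X^2\<close> exceeds \<open>ln k + 1\<close>, the entropy
  \<open>n * ln k\<close> of the labellings is absorbed and a factor \<open>exp (- n)\<close>
  remains.\<close>

lemma union_bound_tendsto_0:
  fixes k :: nat and c C :: real and X :: "nat \<Rightarrow> real"
  assumes k: "0 < k" and c: "0 < c" and C: "0 \<le> C" and X: "filterlim X at_top sequentially"
  shows "(\<lambda>n. real k ^ n * (C * exp (- (c * (X n)\<^sup>2 * real n)))) \<longlonglongrightarrow> 0"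
proof (rule tendsto_sandwich[where f = "\<lambda>_. 0" and h = "\<lambda>n. C * exp (- real n)"])
  \<comment> \<open>The bound 1 serves to pass from \<open>X\<close> to \<open>X^2\<close>.\<close>
  have "eventually (\<lambda>n. X n \<ge> max 1 ((ln (real k) + 1) / c)) sequentially"
    using X unfolding filterlim_at_top by blast
  then show "eventually (\<lambda>n. real k ^ n * (C * exp (- (c * (X n)\<^sup>2 * real n))) \<le> C * exp (- real n)) sequentially"
  proof eventually_elim
    case (elim n)
    then have "X n * 1 \<le> X n * X n"
      by (intro mult_left_mono) auto
    then have "(ln (real k) + 1) / c \<le> (X n)\<^sup>2"
      unfolding power2_eq_square using elim by linarith
    then have "ln (real k) + 1 \<le> c * (X n)\<^sup>2"
      using c by (simp add: field_simps)
    then have "(ln (real k) + 1) * real n \<le> c * (X n)\<^sup>2 * real n"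
      by (intro mult_right_mono) auto
    then have "real n * ln (real k) - c * (X n)\<^sup>2 * real n \<le> - real n"
      by (simp add: algebra_simps)
    then have "exp (real n * ln (real k) - c * (X n)\<^sup>2 * real n) \<le> exp (- real n)"
      by simp
    moreover have "real k ^ n = exp (real n * ln (real k))"
      using k by (simp add: exp_of_nat_mult)
    ultimately have "real k ^ n * exp (- (c * (X n)\<^sup>2 * real n)) \<le> exp (- real n)"
      by (simp flip: exp_add)
    then have "C * (real k ^ n * exp (- (c * (X n)\<^sup>2 * real n))) \<le> C * exp (- real n)"
      using C by (intro mult_left_mono) auto
    then show ?case
      by (simp add: mult_ac)
  qed
  show "(\<lambda>n. C * exp (- real n)) \<longlonglongrightarrow> 0"
    by real_asymp
qed (use C in auto)

text \<open>Treats both criteria at once through the error \<open>r\<close>, which must be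
  negligible against the scale \<open>n^2 * \<rho>\<close> of profile differences. The bound
  \<alpha>0, strictly below the smallest class probability, leaves room for the fluctuations of the
  class sizes uniformly in \<open>n\<close>.\<close>

lemma weakly_consistent_if_approx_profile:
  fixes k :: nat and p :: "nat pmf" and S :: "nat \<Rightarrow> nat \<Rightarrow> real" and \<rho> :: "nat \<Rightarrow> real"
  assumes k: "k \<ge> 2"
    and p_supp: "set_pmf p = {..<k}"
    and S_sym: "\<forall>a<k. \<forall>b<k. S a b = S b a"
    and S_pos: "\<forall>a<k. \<forall>b<k. S a b > 0"
    and S_cols: "\<forall>a<k. \<forall>b<k. a \<noteq> b \<longrightarrow> (\<exists>c<k. S c a \<noteq> S c b)"
    and rho_pos: "\<forall>n. \<rho> n > 0"
    and rho_lim: "\<rho> \<longlonglongrightarrow> 0"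
    and \<alpha>: "\<And>n. 0 < \<alpha> n" "\<And>n. \<alpha> n \<le> \<alpha>0" "\<alpha>0 < Min (pmf p ` {..<k})"
    and \<alpha>_rate: "filterlim (\<lambda>n. \<alpha> n * sqrt (real n * \<rho> n)) at_top sequentially"
    and est: "is_maximizer Q k \<alpha> est"
    and Q: "\<And>n B e. 0 < n \<Longrightarrow>
      \<bar>(real n)\<^sup>2 * Q k n (sym_adj B) e - profile (pairs n) (blocks k) (\<lambda>p. of_bool (B p)) (block e)\<bar> \<le> r n"
    and r: "(\<lambda>n. r n / ((real n)\<^sup>2 * \<rho> n)) \<longlonglongrightarrow> 0"
  shows "weakly_consistent p S \<rho> k est"
  unfolding weakly_consistent_def
proof (intro allI impI)
  fix \<epsilon> :: real assume \<epsilon>: "0 < \<epsilon>"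
  define X where "X = (\<lambda>n. \<alpha> n * sqrt (real n * \<rho> n))"
  define Sset where "Sset = (\<lambda>(a, b). S a b) ` ({..<k} \<times> {..<k})"
  define s0 s1 where "s0 = Min Sset" and "s1 = Max Sset"
  have Sset: "finite Sset" "Sset \<noteq> {}" "\<And>x. x \<in> Sset \<Longrightarrow> 0 < x"
    using k S_pos by (auto simp: Sset_def lessThan_empty_iff)
  have s0: "0 < s0"
    using Sset by (simp add: s0_def)
  have s01: "S a b \<in> {s0..s1}" if "a < k" "b < k" for a b
  proof -
    have "S a b \<in> Sset"
      using that by (force simp: Sset_def)
    then show ?thesis
      using Sset by (simp add: s0_def s1_def)
  qed
  have s1: "s0 \<le> s1" "0 < s1"
    using s01[of 0 0] k s0 by auto
  define D where "D = (\<lambda>(b, b', c). \<bar>S b c - S b' c\<bar>) ` ({..<k} \<times> {..<k} \<times> {..<k})"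
  \<comment> \<open>The smallest nonzero entrywise difference between two rows of \<open>S\<close>;
    inserting 1 keeps the set nonempty.\<close>
  define \<kappa> where "\<kappa> = Min (insert 1 (D - {0}))"
  have D: "finite D" "\<And>x. x \<in> D \<Longrightarrow> 0 \<le> x"
    by (auto simp: D_def)
  have \<kappa>: "0 < \<kappa>"
    using D by (force simp: \<kappa>_def)
  have sep: "\<exists>c<k. \<kappa> \<le> \<bar>S b c - S b' c\<bar>" if b: "b < k" "b' < k" "b \<noteq> b'" for b b'
  proof -
    obtain c where c: "c < k" "S c b \<noteq> S c b'"
      using S_cols b by blast
    then have "\<bar>S b c - S b' c\<bar> \<in> D - {0}"
      using b S_sym by (force simp: D_def)
    then have "\<kappa> \<le> \<bar>S b c - S b' c\<bar>"
      using D by (auto simp: \<kappa>_def intro: Min_le)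
    with c show ?thesis by blast
  qed
  define \<pi> where "\<pi> = Min (pmf p ` {..<k})"
  have \<pi>: "\<pi> \<le> pmf p a" if "a < k" for a
    using that by (auto simp: \<pi>_def intro: Min_le)
  have \<pi>_le: "\<pi> \<le> 1"
    using \<pi>[of 0] k pmf_le_1[of p 0] by linarith
  have k_pos: "0 < k"
    using k by simp
  have S_comm: "S a b = S b a" if "a < k" "b < k" for a b
    using S_sym that by blast
  have \<alpha>0: "0 < \<alpha>0"
    using \<alpha>(1,2) by (meson less_le_trans)
  define \<eta>' where "\<eta>' = \<pi> - \<alpha>0"
  have \<eta>': "0 < \<eta>'" "\<eta>' \<le> 2"
    using \<alpha>(3) \<alpha>0 \<pi>_le by (auto simp: \<eta>'_def \<pi>_def)
  have \<pi>_gap: "\<alpha>0 + \<eta>' \<le> pmf p a" if "a < k" for a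
    using \<pi>[OF that] by (simp add: \<eta>'_def)
  \<comment> \<open>The threshold will be \<open>t = \<gamma> * n\<close>. The first bound makes
    true classes large enough for the pigeonhole step, the second keeps the mismatch
    \<open>k^2 * t\<close> below \<open>\<epsilon> * n\<close>.\<close>
  define \<gamma> where "\<gamma> = min (\<alpha>0 / real k) (\<epsilon> / (2 * real k ^ 2))"
  have \<gamma>: "0 < \<gamma>" "real k * \<gamma> \<le> \<alpha>0" "real k ^ 2 * \<gamma> < \<epsilon>"
  proof -
    show "0 < \<gamma>"
      using \<alpha>0 \<epsilon> k by (simp add: \<gamma>_def)
    have "real k * \<gamma> \<le> real k * (\<alpha>0 / real k)"
      by (intro mult_left_mono) (auto simp: \<gamma>_def)
    then show "real k * \<gamma> \<le> \<alpha>0"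
      using k by simp
    have "real k ^ 2 * \<gamma> \<le> real k ^ 2 * (\<epsilon> / (2 * real k ^ 2))"
      by (intro mult_left_mono) (auto simp: \<gamma>_def)
    then have "real k ^ 2 * \<gamma> \<le> \<epsilon> / 2"
      using k by simp
    then show "real k ^ 2 * \<gamma> < \<epsilon>"
      using \<epsilon> by linarith
  qed
  define M where "M = 1 + \<bar>ln (s0 / 2)\<bar> + \<bar>ln (2 * s1)\<bar>"
  have M: "0 < M"
    by (simp add: M_def)
  \<comment> \<open>The variance budget \<open>t^2 * \<kappa>^2 / 32\<close> per \<open>n^2\<close>.
    The choice of \<eta> below spends at most half of it; the errors from \<rho> and
    \<open>r\<close> eventually fit into the other half.\<close>
  define \<theta> where "\<theta> = \<gamma>\<^sup>2 * \<kappa>\<^sup>2 / 32"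
  have \<theta>: "0 < \<theta>"
    using \<gamma> \<kappa> by (simp add: \<theta>_def)
  define \<eta> where "\<eta> = min (s0 / 2) (\<theta> / (16 * s1 * M))"
  have \<eta>: "0 < \<eta>" "\<eta> \<le> s0 / 2"
    using s0 s1 \<theta> M by (auto simp: \<eta>_def)
  have "8 * s1 * (M * \<eta>) \<le> 8 * s1 * (M * (\<theta> / (16 * s1 * M)))"
    using s1 M by (intro mult_left_mono) (auto simp: \<eta>_def)
  also have "\<dots> = \<theta> / 2"
    using s1 M by simp
  finally have \<eta>_small: "8 * s1 * (M * \<eta>) \<le> \<theta> / 2" .
  define bound where "bound = (\<lambda>n. real k * (2 * exp (- (\<eta>'\<^sup>2 * real n / 4)))
    + real k ^ n * (real (card (blocks k)) * (2 * exp (- (\<eta>\<^sup>2 * \<rho> n * (\<alpha> n * real n)\<^sup>2 / (16 * s1))))))"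
  have "bound = (\<lambda>n. real k * (2 * exp (- (\<eta>'\<^sup>2 * real n / 4)))
    + real k ^ n * ((2 * real (card (blocks k))) * exp (- (\<eta>\<^sup>2 / (16 * s1) * (X n)\<^sup>2 * real n))))"
  proof
    fix n
    have "(X n)\<^sup>2 = (\<alpha> n)\<^sup>2 * (real n * \<rho> n)"
      using rho_pos by (simp add: X_def power_mult_distrib less_imp_le)
    then have "\<eta>\<^sup>2 * \<rho> n * (\<alpha> n * real n)\<^sup>2 / (16 * s1) = \<eta>\<^sup>2 / (16 * s1) * (X n)\<^sup>2 * real n"
      by (simp add: power2_eq_square)
    then show "bound n = real k * (2 * exp (- (\<eta>'\<^sup>2 * real n / 4)))
      + real k ^ n * ((2 * real (card (blocks k))) * exp (- (\<eta>\<^sup>2 / (16 * s1) * (X n)\<^sup>2 * real n)))"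
      by (simp add: bound_def)
  qed
  moreover have "(\<lambda>n. real k * (2 * exp (- (\<eta>'\<^sup>2 * real n / 4)))) \<longlonglongrightarrow> 0"
    using \<eta>'(1) by real_asymp
  moreover have "(\<lambda>n. real k ^ n * ((2 * real (card (blocks k))) * exp (- (\<eta>\<^sup>2 / (16 * s1) * (X n)\<^sup>2 * real n)))) \<longlonglongrightarrow> 0"
    using k \<eta> s1 \<alpha>_rate by (intro union_bound_tendsto_0) (auto simp: X_def)
  ultimately have bound: "bound \<longlonglongrightarrow> 0"
    using tendsto_add[of _ 0 sequentially _ 0] by simp
  have "(\<lambda>n. 8 * s1 * (4 * s1\<^sup>2 * \<rho> n + r n / ((real n)\<^sup>2 * \<rho> n))) \<longlonglongrightarrow> 8 * s1 * (4 * s1\<^sup>2 * 0 + 0)"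
    by (intro tendsto_intros rho_lim r)
  then have ev_small: "eventually (\<lambda>n. 8 * s1 * (4 * s1\<^sup>2 * \<rho> n + r n / ((real n)\<^sup>2 * \<rho> n)) < \<theta> / 2) sequentially"
    using \<theta> by (intro order_tendstoD) auto
  have ev_\<rho>: "eventually (\<lambda>n. \<rho> n < min 1 (1 / (2 * s1))) sequentially"
    using rho_lim s1 by (intro order_tendstoD) auto
  have ev_X: "eventually (\<lambda>n. 2 \<le> X n) sequentially"
    using \<alpha>_rate by (simp add: X_def filterlim_at_top)
  have ev_n: "eventually (\<lambda>n. 2 / \<gamma> \<le> real n) sequentially"
    using filterlim_real_sequentially by (simp add: filterlim_at_top)
  have lower: "eventually (\<lambda>n. 1 - bound n \<le> measure_pmf.prob (sbm p S \<rho> n)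
      {(z, A). real (mismatch k n (est n A) z) < \<epsilon> * real n}) sequentially"
    using ev_small ev_\<rho> ev_X ev_n eventually_gt_at_top[of 0]
  proof eventually_elim
    case (elim n)
    define t where "t = \<gamma> * real n"
    have \<rho>: "0 < \<rho> n" "2 * s1 * \<rho> n < 1"
      using rho_pos elim(2) s1 by (auto simp: field_simps)
    \<comment> \<open>Since \<open>\<rho> n < 1 \<le> n\<close>, \<open>X n\<close> is at most
      \<open>\<alpha> n * n\<close>, so its divergence supplies the minimal class size 2.\<close>
    have "sqrt (real n * \<rho> n) \<le> sqrt ((real n)\<^sup>2)"
    proof (rule real_sqrt_le_mono)
      have "real n * \<rho> n \<le> real n * real n"
        using elim by (intro mult_left_mono) auto
      then show "real n * \<rho> n \<le> (real n)\<^sup>2"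
        by (simp add: power2_eq_square)
    qed
    then have "X n \<le> \<alpha> n * real n"
      unfolding X_def using \<alpha>(1)[of n] by (intro mult_left_mono) auto
    then have \<alpha>n: "2 \<le> \<alpha> n * real n"
      using elim(3) by linarith
    have t2: "2 \<le> t"
      using elim(4) \<gamma>(1) by (simp add: t_def field_simps)
    have kt: "real k * t \<le> \<alpha>0 * real n"
      using mult_right_mono[OF \<gamma>(2), of "real n"] by (simp add: t_def mult.assoc)
    have r_eq: "r n / \<rho> n = (real n)\<^sup>2 * (r n / ((real n)\<^sup>2 * \<rho> n))"
      using elim(5) by simp
    have "8 * s1 * ((real n)\<^sup>2 * (M * \<eta> + 4 * s1\<^sup>2 * \<rho> n) + r n / \<rho> n)
        = (real n)\<^sup>2 * (8 * s1 * (M * \<eta>) + 8 * s1 * (4 * s1\<^sup>2 * \<rho> n + r n / ((real n)\<^sup>2 * \<rho> n)))"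
      unfolding r_eq by (simp add: distrib_left)
    also have "\<dots> \<le> (real n)\<^sup>2 * \<theta>"
      using \<eta>_small elim(1) by (intro mult_left_mono) auto
    also have "\<dots> = t\<^sup>2 * \<kappa>\<^sup>2 / 32"
      by (simp add: t_def \<theta>_def power_mult_distrib)
    finally have small: "8 * s1 * ((real n)\<^sup>2 * (M * \<eta> + 4 * s1\<^sup>2 * \<rho> n) + r n / \<rho> n) \<le> t\<^sup>2 * \<kappa>\<^sup>2 / 32" .
    have bad: "measure_pmf.prob (sbm p S \<rho> n) {(z, A). real (mismatch k n (est n A) z) > real k ^ 2 * t} \<le> bound n"
      unfolding bound_def
      by (rule prob_mismatch_le[where ?s0.0 = s0 and \<kappa> = \<kappa> and Q = Q and \<beta> = \<alpha>0 and r = "r n"])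
        (fact k_pos p_supp \<rho> s0 s1 \<eta> S_comm s01 sep \<kappa> est Q[OF elim(5)] \<alpha>n \<alpha>(2) \<pi>_gap \<eta>' kt t2 small[unfolded M_def])+
    have "real k ^ 2 * t < \<epsilon> * real n"
      using mult_strict_right_mono[OF \<gamma>(3), of "real n"] elim(5) by (simp add: t_def mult.assoc)
    then have "- {(z, A). real (mismatch k n (est n A) z) > real k ^ 2 * t}
        \<subseteq> {(z, A). real (mismatch k n (est n A) z) < \<epsilon> * real n}"
      by auto
    then have "measure_pmf.prob (sbm p S \<rho> n) (- {(z, A). real (mismatch k n (est n A) z) > real k ^ 2 * t})
        \<le> measure_pmf.prob (sbm p S \<rho> n) {(z, A). real (mismatch k n (est n A) z) < \<epsilon> * real n}"
      by (intro measure_pmf.finite_measure_mono) auto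
    moreover have "measure_pmf.prob (sbm p S \<rho> n) (- {(z, A). real (mismatch k n (est n A) z) > real k ^ 2 * t})
        = 1 - measure_pmf.prob (sbm p S \<rho> n) {(z, A). real (mismatch k n (est n A) z) > real k ^ 2 * t}"
      using measure_pmf.prob_compl[of "{(z, A). real (mismatch k n (est n A) z) > real k ^ 2 * t}" "sbm p S \<rho> n"]
      by (simp add: Compl_eq_Diff_UNIV)
    ultimately show ?case
      using bad by linarith
  qed
  have "(\<lambda>n. 1 - bound n) \<longlonglongrightarrow> 1 - 0"
    by (intro tendsto_intros bound)
  then have lim: "(\<lambda>n. 1 - bound n) \<longlonglongrightarrow> 1"
    by simp
  show "(\<lambda>n. measure_pmf.prob (sbm p S \<rho> n)
      {(z, A). real (mismatch k n (est n A) z) < \<epsilon> * real n}) \<longlonglongrightarrow> 1"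
    by (rule tendsto_sandwich[OF lower _ lim tendsto_const]) simp
qed

text \<open>The quotient splits into \<open>ln n / n\<close> and \<open>1 / (n * \<rho>)\<close>, so
  the divergence of \<open>n * \<rho>\<close> may be arbitrarily slow, even slower than
  \<open>ln n\<close>.\<close>

lemma log_error_negligible:
  fixes \<rho> :: "nat \<Rightarrow> real"
  assumes "filterlim (\<lambda>n. real n * \<rho> n) at_top sequentially"
  shows "(\<lambda>n. C * (2 + 3 * ln (2 * (real n)\<^sup>2 + 1)) / ((real n)\<^sup>2 * \<rho> n)) \<longlonglongrightarrow> 0"
proof -
  have "(\<lambda>n. C * (2 + 3 * ln (2 * (real n)\<^sup>2 + 1)) / real n) \<longlonglongrightarrow> 0"
    by real_asymp
  moreover have "(\<lambda>n. inverse (real n * \<rho> n)) \<longlonglongrightarrow> 0"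
    using assms by (rule tendsto_inverse_0_at_top)
  ultimately have "(\<lambda>n. C * (2 + 3 * ln (2 * (real n)\<^sup>2 + 1)) / real n * inverse (real n * \<rho> n)) \<longlonglongrightarrow> 0"
    by (rule tendsto_mult_zero)
  then show ?thesis
    by (simp add: power2_eq_square divide_inverse mult_ac)
qed

theorem theorem1:
  fixes k :: nat and p :: "nat pmf" and S :: "nat \<Rightarrow> nat \<Rightarrow> real" and \<rho> :: "nat \<Rightarrow> real"
  assumes k: "k \<ge> 2"
    and p_supp: "set_pmf p = {..<k}"
    and S_sym: "\<forall>a<k. \<forall>b<k. S a b = S b a"
    and S_pos: "\<forall>a<k. \<forall>b<k. S a b > 0"
    and S_cols: "\<forall>a<k. \<forall>b<k. a \<noteq> b \<longrightarrow> (\<exists>c<k. S c a \<noteq> S c b)"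
    and rho_pos: "\<forall>n. \<rho> n > 0"
    and rho_lim: "\<rho> \<longlonglongrightarrow> 0"
    and nrho: "filterlim (\<lambda>n. real n * \<rho> n) at_top sequentially"
  shows
    "(\<forall>\<alpha>::real. 0 < \<alpha> \<and> \<alpha> < Min (pmf p ` {..<k}) \<longrightarrow>
        (\<forall>est. is_maximizer Q_ML k (\<lambda>_. \<alpha>) est \<longrightarrow> weakly_consistent p S \<rho> k est) \<and>
        (\<forall>est. is_maximizer Q_ICL k (\<lambda>_. \<alpha>) est \<longrightarrow> weakly_consistent p S \<rho> k est))
     \<and>
     (\<forall>\<alpha>::nat \<Rightarrow> real. antimono \<alpha> \<and> (\<forall>n. 0 < \<alpha> n \<and> \<alpha> n < Min (pmf p ` {..<k}))
        \<and> filterlim (\<lambda>n. \<alpha> n * sqrt (real n * \<rho> n)) at_top sequentially \<longrightarrow>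
        (\<forall>est. is_maximizer Q_ML k \<alpha> est \<longrightarrow> weakly_consistent p S \<rho> k est) \<and>
        (\<forall>est. is_maximizer Q_ICL k \<alpha> est \<longrightarrow> weakly_consistent p S \<rho> k est))"
proof -
  have main: "(\<forall>est. is_maximizer Q_ML k \<alpha> est \<longrightarrow> weakly_consistent p S \<rho> k est) \<and>
        (\<forall>est. is_maximizer Q_ICL k \<alpha> est \<longrightarrow> weakly_consistent p S \<rho> k est)"
    if \<alpha>: "antimono \<alpha>" "\<And>n. 0 < \<alpha> n" "\<And>n. \<alpha> n < Min (pmf p ` {..<k})"
      and rate: "filterlim (\<lambda>n. \<alpha> n * sqrt (real n * \<rho> n)) at_top sequentially" for \<alpha> :: "nat \<Rightarrow> real"
  proof -
    \<comment> \<open>Monotonicity supplies the uniform gap: the pointwise inequality with the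
      minimum alone would let \<open>\<alpha> n\<close> approach it.\<close>
    have \<alpha>_le: "\<alpha> n \<le> \<alpha> 0" for n
      using antimonoD[OF \<alpha>(1), of 0 n] by simp
    note * = weakly_consistent_if_approx_profile[OF k p_supp S_sym S_pos S_cols rho_pos rho_lim
        \<alpha>(2) \<alpha>_le \<alpha>(3)[of 0] rate]
    show ?thesis
    proof (intro conjI allI impI)
      fix est assume "is_maximizer Q_ML k \<alpha> est"
      then show "weakly_consistent p S \<rho> k est"
        by (rule *[where r = "\<lambda>_. 0"]) (simp_all add: Q_ML_eq_profile)
    next
      fix est assume "is_maximizer Q_ICL k \<alpha> est"
      then show "weakly_consistent p S \<rho> k est"
      proof (rule *)
        show "(\<lambda>n. real (card (blocks k)) * (2 + 3 * ln (2 * (real n)\<^sup>2 + 1)) / ((real n)\<^sup>2 * \<rho> n)) \<longlonglongrightarrow> 0"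
          by (rule log_error_negligible[OF nrho])
      qed (rule Q_ICL_approx_profile)
    qed
  qed
  have rate: "filterlim (\<lambda>n. \<alpha> * sqrt (real n * \<rho> n)) at_top sequentially" if "0 < \<alpha>" for \<alpha>
    using that nrho by (intro filterlim_tendsto_pos_mult_at_top[OF tendsto_const] filterlim_compose[OF sqrt_at_top]) auto
  show ?thesis
  proof (rule conjI; intro allI impI; elim conjE)
    fix \<alpha> :: real assume "0 < \<alpha>" "\<alpha> < Min (pmf p ` {..<k})"
    then show "(\<forall>est. is_maximizer Q_ML k (\<lambda>_. \<alpha>) est \<longrightarrow> weakly_consistent p S \<rho> k est) \<and>
        (\<forall>est. is_maximizer Q_ICL k (\<lambda>_. \<alpha>) est \<longrightarrow> weakly_consistent p S \<rho> k est)"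
      by (intro main rate) (auto simp: antimono_def)
  next
    fix \<alpha> :: "nat \<Rightarrow> real"
    assume "antimono \<alpha>" "\<forall>n. 0 < \<alpha> n \<and> \<alpha> n < Min (pmf p ` {..<k})"
      "filterlim (\<lambda>n. \<alpha> n * sqrt (real n * \<rho> n)) at_top sequentially"
    then show "(\<forall>est. is_maximizer Q_ML k \<alpha> est \<longrightarrow> weakly_consistent p S \<rho> k est) \<and>
        (\<forall>est. is_maximizer Q_ICL k \<alpha> est \<longrightarrow> weakly_consistent p S \<rho> k est)"
      by (intro main) blast+
  qed
qed

end
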